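(* Let $T: X\to X$ be a continuous self-map of a compact metric space $X$. Suppose that the set $M_e(X,T)$ of ergodic $T$-invariant Borel probability measures is arcwise-connected. Then there exists a dense subset $\mathcal{D}$ of $C(X)$ such that for every $\phi\in\mathcal{D}$ the set $M_{\max}(\phi)$ of $\phi$-maximizing measures contains uncountably many ergodic elements.
   Context: $C(X)$ is the Banach space of continuous functions $X\to\mathbb{R}$ with the supremum norm. $M(X,T)$ is the space of $T$-invariant Borel probability measures on $X$ with the weak*-topology, and $M_e(X,T)\subset M(X,T)$ is the subset of ergodic measures (with the subspace topology). For $\phi\in C(X)$, a measure $\mu\in M(X,T)$ is $\phi$-maximizing if $\int\phi\,d\mu=\max_{\nu\in M(X,T)}\int\phi\,d\nu$; $M_{\max}(\phi)$ denotes the set of all $\phi$-maximizing measures. $M_e(X,T)$ is called arcwise-connected if it has at least two elements and for every two distinct $\mu,\nu\in M_e(X,T)$ there is a map $[0,1]\ni t\mapsto f_t\in M_e(X,T)$ that is a homeomorphism onto its image with $f_0=\mu$ and $f_1=\nu$. *)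

theory Defs
  imports "HOL-Probability.Probability"
begin

text \<open>
  A compact metric space \<open>X\<close> is a type of class \<^class>\<open>metric_space\<close> whose universe is
  compact. On such a type every continuous real function is bounded, so that
  \<open>'a \<Rightarrow>\<^sub>C real\<close> is the Banach space \<open>C(X)\<close> with the supremum norm.
\<close>

definition invariant_measures :: "('a::metric_space \<Rightarrow> 'a) \<Rightarrow> 'a measure set" where
  "invariant_measures T = {\<mu>. prob_space \<mu> \<and> sets \<mu> = sets borel \<and> distr \<mu> borel T = \<mu>}"

definition ergodic_measures :: "('a::metric_space \<Rightarrow> 'a) \<Rightarrow> 'a measure set" where
  "ergodic_measures T =
     {\<mu> \<in> invariant_measures T.
        \<forall>A \<in> sets borel. T -` A = A \<longrightarrow> measure \<mu> A = 0 \<or> measure \<mu> A = 1}"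

text \<open>
  The weak* topology is the coarsest topology on the invariant measures that makes
  \<open>\<mu> \<mapsto> \<integral>\<phi> d\<mu>\<close> continuous for every \<open>\<phi> \<in> C(X)\<close>.
\<close>

definition weak_star_topology :: "('a::metric_space \<Rightarrow> 'a) \<Rightarrow> 'a measure topology" where
  "weak_star_topology T = topology_generated_by
     {{\<mu> \<in> invariant_measures T. (\<integral>x. apply_bcontfun \<phi> x \<partial>\<mu>) \<in> U} |
        (\<phi> :: 'a \<Rightarrow>\<^sub>C real) (U :: real set). open U}"

lemma topspace_weak_star_topology [simp]:
  "topspace (weak_star_topology T) = invariant_measures T"
  unfolding weak_star_topology_def topology_generated_by_topspace
  by (auto intro!: exI[of _ UNIV])

definition arcwise_connected_ergodic :: "('a::metric_space \<Rightarrow> 'a) \<Rightarrow> bool" where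
  "arcwise_connected_ergodic T \<longleftrightarrow>
     (\<exists>\<mu> \<in> ergodic_measures T. \<exists>\<nu> \<in> ergodic_measures T. \<mu> \<noteq> \<nu>) \<and>
     (\<forall>\<mu> \<in> ergodic_measures T. \<forall>\<nu> \<in> ergodic_measures T. \<mu> \<noteq> \<nu> \<longrightarrow>
        (\<exists>f :: real \<Rightarrow> 'a measure.
           embedding_map (top_of_set {0..1})
             (subtopology (weak_star_topology T) (ergodic_measures T)) f \<and>
           f 0 = \<mu> \<and> f 1 = \<nu>))"

definition maximizing_measures ::
    "('a::metric_space \<Rightarrow> 'a) \<Rightarrow> ('a \<Rightarrow>\<^sub>C real) \<Rightarrow> 'a measure set" where
  "maximizing_measures T \<phi> =
     {\<mu> \<in> invariant_measures T. \<forall>\<nu> \<in> invariant_measures T.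
        (\<integral>x. apply_bcontfun \<phi> x \<partial>\<nu>) \<le> (\<integral>x. apply_bcontfun \<phi> x \<partial>\<mu>)}"

end

(*
Write Gamma(phi) for the maximum of the integral of phi over the invariant measures. Given phi0,
follow an arc of ergodic measures starting at an ergodic phi0-maximizing measure and let nu be
the average of the measures on a short initial piece of it, so that F(psi) = Gamma(psi) - nu(psi)
is nonnegative and at most e^2 at phi0. Ekeland's principle gives phi within e of phi0 that
minimizes psi |-> F(psi) + e * |psi - phi|.

Suppose that phi has only countably many ergodic maximizing measures. By Birkhoff's theorem each
of them is carried by a set that is null for every other ergodic measure. Since nu charges no
single point of the arc, the union of these sets is nu-null, so a closed set K disjoint from it
has nu(K) > 1/2. Perturbing phi by small multiples of bump functions around K, the minimality of
phi shows that some phi-maximizing measure charges K; an extreme point argument then yields an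
ergodic one, a contradiction. This replaces the ergodic decomposition and the Bishop-Phelps
theorem of the usual proof.
*)

theory Submission
  imports Defs
begin

section \<open>Borel probability measures on a compact metric space\<close>

text \<open>Minimality of phi makes nu a subgradient of Gamma at phi up to a norm error e. Adding t
  * h with 0 <= h <= 1 and dividing by t shows that a measure maximizing the perturbed function
  gives h at least nu(h) - e. Hence the constants must satisfy e < nu(K). The initial error is e^2
  because Ekeland's principle trades it for the distance e^2 / e = e at slope e.

  The arc enters twice: its continuity makes nu nearly maximizing for phi0, and its injectivity
  gives each single ergodic measure at most one parameter. A set that is null for all ergodic
  measures but one is therefore nu-null, and countability allows all exceptional measures to be
  removed at once.

  The extreme point is found by maximizing the masses of countably many closed sets one after
  another; stability under conditioning on invariant sets plays the part of extremality. This and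
  every passage to a limit measure rest on sequential weak compactness, which is transported from
  the real line by a Borel code of the points.\<close>

lemma compact_UNIV_fine_open_sequence:
  assumes "compact (UNIV :: 'a::metric_space set)"
  obtains U :: "nat \<Rightarrow> 'a::metric_space set" where "\<And>j. open (U j)"
    and "\<And>e. e > 0 \<Longrightarrow> \<exists>N. \<forall>x. \<exists>j<N. x \<in> U j \<and> (\<forall>y \<in> U j. dist x y < e)"
proof -
  have "\<forall>n. \<exists>k. finite k \<and> UNIV \<subseteq> (\<Union>x\<in>k. ball (x::'a) (1 / Suc n))"
    using seq_compact_imp_totally_bounded[of "UNIV :: 'a set"] assms
    by (simp add: compact_eq_seq_compact_metric)
  then obtain c where fin: "\<And>n. finite (c n)" and cov: "\<And>n. UNIV \<subseteq> (\<Union>x\<in>c n. ball (x::'a) (1 / Suc n))"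
    by metis
  define I where "I = (SIGMA n:UNIV. c n)"
  define W where "W = (\<lambda>(n, x). ball (x::'a) (1 / Suc n))"
  have "countable I" unfolding I_def
    by (intro countable_SIGMA) (auto intro: countable_finite fin)
  obtain x0 where "x0 \<in> c 0" using cov[of 0] by auto
  then have "I \<noteq> {}" unfolding I_def by auto
  define U where "U = (\<lambda>j. W (from_nat_into I j))"
  show thesis
  proof
    show "open (U j)" for j unfolding U_def W_def by (auto split: prod.split)
  next
    fix e :: real assume "e > 0"
    then obtain n :: nat where n: "2 / Suc n < e"
      using reals_Archimedean[of "e/2"] by (auto simp: field_simps)
    \<comment> \<open>The balls of radius \<open>1 / Suc n\<close> occupy finitely many positions of
      the enumeration; \<open>N\<close> bounds these positions.\<close>
    define J where "J = to_nat_on I ` (Pair n ` c n)"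
    have "finite J" unfolding J_def using fin by auto
    then obtain N where N: "\<And>j. j \<in> J \<Longrightarrow> j < N"
      unfolding finite_nat_set_iff_bounded by auto
    have "\<exists>j<N. x \<in> U j \<and> (\<forall>y \<in> U j. dist x y < e)" for x
    proof -
      obtain z where z: "z \<in> c n" "x \<in> ball z (1 / Suc n)" using cov[of n] by blast
      define j where "j = to_nat_on I (n, z)"
      have "(n, z) \<in> I" using z by (auto simp: I_def)
      then have U: "U j = ball z (1 / Suc n)"
        unfolding U_def j_def by (simp add: \<open>countable I\<close> W_def)
      have "dist x y < e" if "y \<in> U j" for y
      proof -
        have "dist x y \<le> dist z x + dist z y" by (metis dist_commute dist_triangle)
        also have "\<dots> < 1 / Suc n + 1 / Suc n"
          using z(2) that unfolding U by (intro add_strict_mono) auto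
        finally show ?thesis using n by simp
      qed
      moreover have "j < N" using N z(1) unfolding J_def j_def by auto
      ultimately show ?thesis using z U by auto
    qed
    then show "\<exists>N. \<forall>x. \<exists>j<N. x \<in> U j \<and> (\<forall>y \<in> U j. dist x y < e)" by auto
  qed
qed

text \<open>Closedness makes \<open>measure \<mu> (E j)\<close> upper semicontinuous in
  \<open>\<mu>\<close>, intersection stability makes these masses determine \<open>\<mu>\<close>,
  and countability allows them to be maximized one after another. Complements of finite unions of
  basic open sets have all three properties.\<close>

lemma compact_UNIV_countable_closed_generator:
  assumes "compact (UNIV :: 'a::metric_space set)"
  obtains E :: "nat \<Rightarrow> 'a::metric_space set" where "\<And>j. closed (E j)" "Int_stable (range E)"
    "UNIV \<in> range E" "sigma_sets UNIV (range E) = sets borel"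
proof -
  obtain U :: "nat \<Rightarrow> 'a set" where op: "\<And>j. open (U j)"
    and fine: "\<And>e. e > 0 \<Longrightarrow> \<exists>N. \<forall>x. \<exists>j<N. x \<in> U j \<and> (\<forall>y \<in> U j. dist x y < e)"
    using compact_UNIV_fine_open_sequence[OF assms] by metis
  have basis: "topological_basis (range U)"
  proof (rule topological_basisI)
    fix O' :: "'a set" and x assume "open O'" "x \<in> O'"
    then obtain e where e: "e > 0" "ball x e \<subseteq> O'" by (meson openE)
    obtain j where "x \<in> U j" "\<forall>y \<in> U j. dist x y < e" using fine[OF e(1)] by metis
    then show "\<exists>B'\<in>range U. x \<in> B' \<and> B' \<subseteq> O'" using e by force
  qed (auto simp: op)
  define \<E> where "\<E> = (\<lambda>F. - \<Union>F) ` {F. finite F \<and> F \<subseteq> range U}"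
  have "countable \<E>" unfolding \<E>_def
    by (intro countable_image countable_Collect_finite_subset) auto
  moreover have "UNIV \<in> \<E>" unfolding \<E>_def by (auto intro: rev_image_eqI[of "{}"])
  moreover define E where "E = from_nat_into \<E>"
  ultimately have E: "range E = \<E>" by (metis range_from_nat_into empty_iff)
  show thesis
  proof
    have "closed C" if "C \<in> \<E>" for C
      using that op unfolding \<E>_def by (auto intro!: closed_Compl open_Union)
    then show "closed (E j)" for j using E by blast
    show "UNIV \<in> range E" unfolding E by fact
    show "Int_stable (range E)"
      unfolding E
    proof (rule Int_stableI)
      fix a b assume "a \<in> \<E>" "b \<in> \<E>"
      then obtain F G where "a = - \<Union>F" "b = - \<Union>G" "finite F" "F \<subseteq> range U" "finite G" "G \<subseteq> range U"
        unfolding \<E>_def by auto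
      then show "a \<inter> b \<in> \<E>" unfolding \<E>_def by (intro image_eqI[of _ _ "F \<union> G"]) auto
    qed
    have sb: "sets borel = sigma_sets UNIV (range U)"
      unfolding borel_eq_countable_basis[OF countable_image[OF countableI_type] basis]
      by (simp add: sets_measure_of_conv)
    also have "\<dots> = sigma_sets UNIV \<E>"
    proof (rule sigma_sets_eqI)
      fix a assume "a \<in> range U"
      then have "- a \<in> \<E>" unfolding \<E>_def by (intro image_eqI[of _ _ "{a}"]) auto
      then have "UNIV - (- a) \<in> sigma_sets UNIV \<E>" by (intro sigma_sets.Compl sigma_sets.Basic)
      then show "a \<in> sigma_sets UNIV \<E>" by simp
    next
      fix b assume "b \<in> \<E>"
      then obtain F where F: "b = - \<Union>F" "finite F" "F \<subseteq> range U" unfolding \<E>_def by auto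
      then have "b \<in> sets borel" using op by (auto intro!: borel_closed closed_Compl open_Union)
      then show "b \<in> sigma_sets UNIV (range U)" using sb by simp
    qed
    finally show "sigma_sets UNIV (range E) = sets borel" unfolding E by simp
  qed
qed

section \<open>Uniqueness, bump functions and regularity for Borel probabilities\<close>

definition borel_probs :: "'a::topological_space measure set" where
  "borel_probs = {\<mu>. prob_space \<mu> \<and> sets \<mu> = sets borel}"

lemma borel_probsD:
  assumes "\<mu> \<in> borel_probs"
  shows "prob_space \<mu>" "sets \<mu> = sets borel" "space \<mu> = UNIV"
    "\<And>f. f \<in> measurable borel N \<Longrightarrow> f \<in> measurable \<mu> N"
  using assms sets_eq_imp_space_eq[of \<mu> borel]
  by (auto simp: borel_probs_def cong: measurable_cong_sets)

lemma invariant_measuresD: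
  "\<mu> \<in> invariant_measures T \<Longrightarrow> \<mu> \<in> borel_probs"
  "\<mu> \<in> invariant_measures T \<Longrightarrow> distr \<mu> borel T = \<mu>"
  by (auto simp: invariant_measures_def borel_probs_def)

lemma ergodic_measuresD:
  "\<mu> \<in> ergodic_measures T \<Longrightarrow> \<mu> \<in> invariant_measures T"
  by (auto simp: ergodic_measures_def)

lemma borel_probs_integrable:
  fixes f :: "'a::topological_space \<Rightarrow> real"
  assumes "\<mu> \<in> borel_probs" "f \<in> borel_measurable borel" "bounded (range f)"
  shows "integrable \<mu> f"
proof -
  interpret prob_space \<mu> using borel_probsD[OF assms(1)] by auto
  obtain B where "\<And>x. norm (f x) \<le> B" using assms(3) by (auto simp: bounded_iff)
  then show ?thesis
    using borel_probsD[OF assms(1)] assms(2) by (intro integrable_const_bound[of _ B]) auto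
qed

lemma borel_probs_eqI_generator:
  fixes E :: "nat \<Rightarrow> 'a::topological_space set"
  assumes "Int_stable (range E)" "UNIV \<in> range E" "sigma_sets UNIV (range E) = sets borel"
    and "\<mu> \<in> borel_probs" "\<nu> \<in> borel_probs" and eq: "\<And>j. measure \<mu> (E j) = measure \<nu> (E j)"
  shows "\<mu> = \<nu>"
proof (rule measure_eqI_generator_eq[of "range E" UNIV _ _ "\<lambda>_. UNIV"])
  interpret \<mu>: prob_space \<mu> using borel_probsD[OF assms(4)] by auto
  interpret \<nu>: prob_space \<nu> using borel_probsD[OF assms(5)] by auto
  show "emeasure \<mu> X = emeasure \<nu> X" if "X \<in> range E" for X
    using that eq by (auto simp: \<mu>.emeasure_eq_measure \<nu>.emeasure_eq_measure)
  show "emeasure \<mu> UNIV \<noteq> \<infinity>" for i :: nat by simp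
qed (use assms borel_probsD(2)[OF assms(4)] borel_probsD(2)[OF assms(5)] in auto)

text \<open>The condition \<open>C \<noteq> {}\<close> in the lemmas below excludes the junk value \<open>infdist x {} = 0\<close>.\<close>

definition bump :: "'a::metric_space set \<Rightarrow> nat \<Rightarrow> 'a \<Rightarrow> real" where
  "bump C m x = max 0 (1 - m * infdist x C)"

lemma bump_bounds: "0 \<le> bump C m x" "bump C m x \<le> 1" "\<bar>bump C m x\<bar> \<le> 1"
  unfolding bump_def by (auto simp: infdist_nonneg)

lemma bump_antimono: "m \<le> n \<Longrightarrow> bump C n x \<le> bump C m x"
  unfolding bump_def by (intro max.mono diff_left_mono mult_right_mono) (auto simp: infdist_nonneg)

lemma indicator_le_bump: "indicator C x \<le> bump C m x"
  unfolding bump_def by (auto simp: indicator_def)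

lemma continuous_on_bump [continuous_intros]: "continuous_on S (bump C m)"
  unfolding bump_def by (intro continuous_intros)

lemma bump_measurable [measurable]: "bump C m \<in> borel_measurable borel"
  by (intro borel_measurable_continuous_onI continuous_intros)

lemma bounded_bump: "bounded (range (bump C m))"
  by (rule boundedI[of _ 1]) (auto simp: bump_bounds)

lemma bump_tendsto_indicator:
  assumes "closed C" "C \<noteq> {}"
  shows "(\<lambda>m. bump C m x) \<longlonglongrightarrow> indicator C x"
proof (cases "x \<in> C")
  case True
  then have "bump C m x = 1" for m by (simp add: bump_def)
  then show ?thesis using True by simp
next
  case False
  then have pos: "infdist x C > 0"
    using assms by (metis in_closed_iff_infdist_zero infdist_nonneg less_eq_real_def)
  obtain N :: nat where N: "1 / infdist x C < N" using reals_Archimedean2 by blast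
  have "bump C m x = 0" if "m \<ge> N" for m
  proof -
    have "1 / infdist x C < m" using N that by (meson less_le_trans of_nat_le_iff)
    then show ?thesis using pos by (auto simp: bump_def field_simps max_def)
  qed
  then have "\<forall>\<^sub>F m in sequentially. bump C m x = 0" by (auto simp: eventually_sequentially)
  then show ?thesis using False by (simp add: tendsto_eventually)
qed

lemma integral_bump_tendsto:
  assumes "closed C" "C \<noteq> {}" "\<mu> \<in> borel_probs"
  shows "(\<lambda>m. \<integral>x. bump C m x \<partial>\<mu>) \<longlonglongrightarrow> measure \<mu> C"
proof -
  interpret prob_space \<mu> using borel_probsD[OF assms(3)] by auto
  have C: "C \<in> sets \<mu>" using assms(1) borel_probsD(2)[OF assms(3)] by auto
  have "(\<lambda>m. \<integral>x. bump C m x \<partial>\<mu>) \<longlonglongrightarrow> (\<integral>x. indicator C x \<partial>\<mu>)"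
    by (rule integral_dominated_convergence[where w="\<lambda>_. 1"])
       (use C borel_probsD[OF assms(3)] in \<open>auto intro!: bump_tendsto_indicator assms simp: bump_bounds\<close>)
  then show ?thesis using C by simp
qed

lemma measure_le_integral_bump:
  assumes "closed C" "\<mu> \<in> borel_probs"
  shows "measure \<mu> C \<le> (\<integral>x. bump C m x \<partial>\<mu>)"
proof -
  interpret prob_space \<mu> using borel_probsD[OF assms(2)] by auto
  have C: "C \<in> sets \<mu>" using assms borel_probsD(2)[OF assms(2)] by auto
  have "(\<integral>x. indicator C x \<partial>\<mu>) \<le> (\<integral>x. bump C m x \<partial>\<mu>)"
    by (rule integral_mono)
       (use C assms in \<open>auto intro!: borel_probs_integrable bounded_bump boundedI[of _ 1]
          simp: indicator_le_bump\<close>)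
  then show ?thesis using C by simp
qed

lemma Int_stable_closed: "Int_stable {C. closed C}"
  by (auto intro!: Int_stableI)

lemma sets_borel_eq_sigma_closed: "sets (borel :: 'a::topological_space measure) = sigma_sets UNIV {C. closed C}"
  unfolding borel_eq_closed by (simp add: sets_measure_of_conv)

lemma borel_probs_eqI_continuous:
  fixes \<mu> \<nu> :: "'a::metric_space measure"
  assumes "\<mu> \<in> borel_probs" "\<nu> \<in> borel_probs"
    and eq: "\<And>f :: 'a \<Rightarrow> real. continuous_on UNIV f \<Longrightarrow> bounded (range f) \<Longrightarrow> (\<integral>x. f x \<partial>\<mu>) = (\<integral>x. f x \<partial>\<nu>)"
  shows "\<mu> = \<nu>"
proof (rule measure_eqI_generator_eq[of "{C. closed C}" UNIV _ _ "\<lambda>_. UNIV"])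
  interpret \<mu>: prob_space \<mu> using borel_probsD[OF assms(1)] by auto
  interpret \<nu>: prob_space \<nu> using borel_probsD[OF assms(2)] by auto
  show "emeasure \<mu> C = emeasure \<nu> C" if "C \<in> {C. closed C}" for C
  proof (cases "C = {}")
    case False
    have "(\<integral>x. bump C m x \<partial>\<mu>) = (\<integral>x. bump C m x \<partial>\<nu>)" for m
      by (intro eq continuous_intros bounded_bump)
    moreover have "closed C" using that by simp
    ultimately have "measure \<mu> C = measure \<nu> C"
      using integral_bump_tendsto[OF _ False assms(1)] integral_bump_tendsto[OF _ False assms(2)]
      by (intro LIMSEQ_unique) auto
    then show ?thesis by (simp add: \<mu>.emeasure_eq_measure \<nu>.emeasure_eq_measure)
  qed simp
  show "emeasure \<mu> UNIV \<noteq> \<infinity>" for i :: nat by simp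
qed (simp_all add: borel_probsD(2)[OF assms(1)] borel_probsD(2)[OF assms(2)]
      Int_stable_closed sets_borel_eq_sigma_closed)

text \<open>Inner and outer approximation are carried together, so that a complement merely
  exchanges the two sets and the property passes from the closed sets to the sigma-algebra they
  generate.\<close>

lemma borel_probs_regular:
  fixes \<mu> :: "'a::metric_space measure"
  assumes "\<mu> \<in> borel_probs" "A \<in> sets borel"
  shows "\<forall>e>0. \<exists>C U. closed C \<and> open U \<and> C \<subseteq> A \<and> A \<subseteq> U \<and> measure \<mu> (U - C) < e"
proof -
  interpret prob_space \<mu> using borel_probsD[OF assms(1)] by auto
  note [simp] = borel_probsD(2)[OF assms(1)]
  have "A \<in> sigma_sets UNIV {C. closed C}"
    using assms(2) sets_borel_eq_sigma_closed by auto
  then show ?thesis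
  proof induction
    case (Basic C)
    show ?case
    proof (intro allI impI)
      fix e :: real assume "e > 0"
      show "\<exists>D U. closed D \<and> open U \<and> D \<subseteq> C \<and> C \<subseteq> U \<and> measure \<mu> (U - D) < e"
      proof (cases "C = {}")
        case True
        then show ?thesis using \<open>e > 0\<close> by (intro exI[of _ "{}"]) auto
      next
        case False
        have C: "closed C" using Basic by auto
        define U where "U m = {x. infdist x C < 1 / Suc m}" for m :: nat
        have op: "open (U m)" for m unfolding U_def by (intro open_Collect_less continuous_intros)
        have "decseq U"
          unfolding U_def by (intro decseq_SucI) (auto intro: less_le_trans simp: frac_le)
        then have "(\<lambda>m. measure \<mu> (U m)) \<longlonglongrightarrow> measure \<mu> (\<Inter>m. U m)"
          using op by (intro finite_Lim_measure_decseq) auto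
        moreover have "(\<Inter>m. U m) = C"
        proof
          show "(\<Inter>m. U m) \<subseteq> C"
          proof
            fix x assume x: "x \<in> (\<Inter>m. U m)"
            have "infdist x C \<le> 0"
            proof (rule ccontr)
              assume "\<not> ?thesis"
              then obtain n where "1 / Suc n < infdist x C"
                using reals_Archimedean[of "infdist x C"] by (auto simp: inverse_eq_divide)
              then show False using x by (auto simp: U_def dest: spec[of _ n])
            qed
            then show "x \<in> C" using C False
              by (metis in_closed_iff_infdist_zero infdist_nonneg order_antisym)
          qed
        qed (auto simp: U_def)
        ultimately have "\<forall>\<^sub>F m in sequentially. measure \<mu> (U m) < measure \<mu> C + e"
          using \<open>e > 0\<close> by (auto intro: order_tendstoD)
        then obtain m where m: "measure \<mu> (U m) < measure \<mu> C + e"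
          by (auto simp: eventually_sequentially)
        have sub: "C \<subseteq> U m" by (auto simp: U_def)
        have "measure \<mu> (U m - C) < e"
          using m finite_measure_Diff[of "U m" C] sub op C by auto
        then show ?thesis using C op sub by blast
      qed
    qed
  next
    case Empty
    show ?case by (intro allI impI exI[of _ "{}"]) auto
  next
    case (Compl A)
    show ?case
    proof (intro allI impI)
      fix e :: real assume "e > 0"
      then obtain C U where "closed C" "open U" "C \<subseteq> A" "A \<subseteq> U" "measure \<mu> (U - C) < e"
        using Compl.IH[rule_format, OF \<open>e > 0\<close>] by blast
      moreover have "- C - (- U) = U - C" by auto
      ultimately show "\<exists>D V. closed D \<and> open V \<and> D \<subseteq> UNIV - A \<and> UNIV - A \<subseteq> V \<and> measure \<mu> (V - D) < e"
        by (intro exI[of _ "- U"] exI[of _ "- C"]) auto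
    qed
  next
    case (Union A)
    show ?case
    proof (intro allI impI)
      fix e :: real assume "e > 0"
      \<comment> \<open>These gaps add up to \<open>e / 2\<close>. The other half pays for replacing
        the infinite union of closed sets, which need not be closed, by the finite union
        \<open>D n\<close>.\<close>
      have "\<exists>C U. closed C \<and> open U \<and> C \<subseteq> A i \<and> A i \<subseteq> U \<and> measure \<mu> (U - C) < e / 4 * (1/2)^i" for i
        using \<open>e > 0\<close> by (intro Union.IH[rule_format]) simp
      then obtain C U where CU: "\<And>i. closed (C i)" "\<And>i. open (U i)" "\<And>i. C i \<subseteq> A i"
        "\<And>i. A i \<subseteq> U i" "\<And>i. measure \<mu> (U i - C i) < e / 4 * (1/2)^i"
        by metis
      note [intro] = borel_open borel_closed
      define D where "D n = (\<Union>i<n. C i)" for n :: nat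
      have D: "closed (D n)" "D n \<subseteq> \<Union>(range A)" for n
        unfolding D_def using CU(1,3) by (auto intro!: closed_UN)
      have [simp]: "C i \<in> sets borel" "U i \<in> sets borel" "D i \<in> sets borel" for i
        using CU(1,2) D(1) by auto
      have [simp]: "(\<Union>i. C i) \<in> sets borel" "(\<Union>i. U i) \<in> sets borel" "(\<Union>i. U i - C i) \<in> sets borel"
        by (auto intro!: sets.countable_UN sets.Diff)
      have "decseq (\<lambda>n. (\<Union>i. C i) - D n)"
        unfolding D_def by (intro decseq_SucI) (auto simp: lessThan_Suc)
      then have "(\<lambda>n. measure \<mu> ((\<Union>i. C i) - D n)) \<longlonglongrightarrow> measure \<mu> (\<Inter>n. (\<Union>i. C i) - D n)"
        by (intro finite_Lim_measure_decseq) (auto intro: sets.Diff)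
      also have "(\<Inter>n. (\<Union>i. C i) - D n) = {}" by (force simp: D_def)
      also have "measure \<mu> {} = 0" by simp
      finally have "(\<lambda>n. measure \<mu> ((\<Union>i. C i) - D n)) \<longlonglongrightarrow> 0" .
      then have "\<forall>\<^sub>F n in sequentially. measure \<mu> ((\<Union>i. C i) - D n) < e / 2"
        using \<open>e > 0\<close> by (intro order_tendstoD(2)) auto
      then obtain n where n: "measure \<mu> ((\<Union>i. C i) - D n) < e / 2"
        by (auto simp: eventually_sequentially)
      have sums: "(\<lambda>i. e / 4 * (1/2)^i) sums (e / 4 * 2)"
        using sums_mult[OF geometric_sums[of "1/2::real"], of "e/4"] by simp
      have summ: "summable (\<lambda>i. measure \<mu> (U i - C i))"
        by (rule summable_comparison_test'[OF sums_summable[OF sums]])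
           (use CU in \<open>auto intro: less_imp_le\<close>)
      have "measure \<mu> (\<Union>i. U i - C i) \<le> (\<Sum>i. measure \<mu> (U i - C i))"
        using summ by (intro finite_measure_subadditive_countably) (auto intro: sets.Diff)
      also have "\<dots> \<le> (\<Sum>i. e / 4 * (1/2)^i)"
        using CU summ sums by (intro suminf_le) (auto intro: less_imp_le sums_summable)
      also have "\<dots> = e / 2" using sums by (simp add: sums_iff)
      finally have 1: "measure \<mu> (\<Union>i. U i - C i) \<le> e / 2" .
      have "measure \<mu> ((\<Union>i. U i) - D n) \<le> measure \<mu> ((\<Union>i. U i - C i) \<union> ((\<Union>i. C i) - D n))"
        by (intro finite_measure_mono) (auto intro!: sets.Un sets.Diff)
      also have "\<dots> \<le> measure \<mu> (\<Union>i. U i - C i) + measure \<mu> ((\<Union>i. C i) - D n)"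
        by (intro measure_Un_le) (auto intro: sets.Diff)
      also have "\<dots> < e" using 1 n by simp
      finally have "measure \<mu> ((\<Union>i. U i) - D n) < e" .
      then show "\<exists>C V. closed C \<and> open V \<and> C \<subseteq> \<Union>(range A) \<and> \<Union>(range A) \<subseteq> V \<and> measure \<mu> (V - C) < e"
        using CU(2,4) D[of n] by (intro exI[of _ "D n"] exI[of _ "\<Union>i. U i"]) (auto intro!: open_UN)
    qed
  qed
qed


section \<open>Weak compactness\<close>

definition weak_lim :: "(nat \<Rightarrow> 'a::topological_space measure) \<Rightarrow> 'a measure \<Rightarrow> bool" where
  "weak_lim m l \<longleftrightarrow> (\<forall>f :: 'a \<Rightarrow> real. continuous_on UNIV f \<longrightarrow> bounded (range f) \<longrightarrow>
     (\<lambda>n. \<integral>x. f x \<partial>m n) \<longlonglongrightarrow> (\<integral>x. f x \<partial>l))"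

lemma weak_limD:
  "weak_lim m l \<Longrightarrow> continuous_on UNIV f \<Longrightarrow> bounded (range f) \<Longrightarrow>
     (\<lambda>n. \<integral>x. f x \<partial>m n) \<longlonglongrightarrow> (\<integral>x. (f x :: real) \<partial>l)"
  by (auto simp: weak_lim_def)

lemma weak_lim_subseq: "weak_lim m l \<Longrightarrow> strict_mono r \<Longrightarrow> weak_lim (m \<circ> r) l"
  unfolding weak_lim_def using LIMSEQ_subseq_LIMSEQ by (force simp: o_def)

text \<open>In base 4 the digits after position \<open>j\<close> contribute at most
  \<open>(1/4)^j / 3\<close>, too little to cancel a leading digit of modulus 1. In base 2 they
  could cancel it completely.\<close>

lemma quarter_series_lower_bound:
  fixes c :: "nat \<Rightarrow> real"
  assumes "\<And>i. \<bar>c i\<bar> \<le> 1" "\<And>i. i < j \<Longrightarrow> c i = 0" "\<bar>c j\<bar> = 1"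
  shows "2/3 * (1/4)^j \<le> \<bar>\<Sum>i. c i * (1/4)^i\<bar>"
proof -
  define f where "f i = c i * (1/4)^i" for i
  have geo: "summable (\<lambda>i. (1/4::real)^(i + k))" for k
    by (subst summable_iff_shift) (simp add: summable_geometric)
  have f_le: "\<bar>f i\<bar> \<le> (1/4)^i" for i
    using assms(1)[of i] by (auto simp: f_def abs_mult intro: mult_left_le_one_le)
  have summ: "summable f"
    by (rule summable_comparison_test'[OF geo[of 0], of 0]) (use f_le in simp)
  have "suminf f = (\<Sum>i. f (i + Suc j)) + (\<Sum>i<Suc j. f i)"
    by (rule suminf_split_initial_segment[OF summ])
  moreover have "(\<Sum>i<Suc j. f i) = f j" using assms(2) by (simp add: f_def)
  moreover have "\<bar>\<Sum>i. f (i + Suc j)\<bar> \<le> (1/4)^j / 3"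
  proof -
    have "norm (\<Sum>i. f (i + Suc j)) \<le> (\<Sum>i. (1/4)^(i + Suc j))"
      by (intro norm_suminf_le geo) (simp only: real_norm_def f_le)
    also have "(\<Sum>i. (1/4::real)^(i + Suc j)) = (\<Sum>i. (1/4)^i) * (1/4)^Suc j"
      unfolding power_add by (rule suminf_mult2[symmetric]) (simp add: summable_geometric)
    also have "\<dots> = (1/4)^j / 3" by (simp add: suminf_geometric)
    finally show ?thesis by simp
  qed
  moreover have "\<bar>f j\<bar> = (1/4)^j" using assms(3) by (simp add: f_def abs_mult)
  ultimately show ?thesis unfolding f_def[symmetric] by linarith
qed

text \<open>The base 4 digits of \<open>s x\<close> record which sets \<open>U j\<close> contain
  \<open>x\<close>. Points at distance at least \<open>e\<close> disagree at some digit before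
  \<open>N\<close>, so their codes differ by at least \<open>2/3 * (1/4)^N\<close>.\<close>

lemma compact_UNIV_code:
  assumes "compact (UNIV :: 'a::metric_space set)"
  obtains s :: "'a::metric_space \<Rightarrow> real" where "s \<in> borel_measurable borel" "\<And>x. s x \<in> {0..2}"
    "\<And>e. e > 0 \<Longrightarrow> \<exists>d>0. \<forall>x y. \<bar>s x - s y\<bar> < d \<longrightarrow> dist x y < e"
proof -
  obtain U :: "nat \<Rightarrow> 'a set" where op: "\<And>j. open (U j)"
    and fine: "\<And>e. e > 0 \<Longrightarrow> \<exists>N. \<forall>x. \<exists>j<N. x \<in> U j \<and> (\<forall>y \<in> U j. dist x y < e)"
    using compact_UNIV_fine_open_sequence[OF assms] by metis
  define s :: "'a \<Rightarrow> real" where "s x = (\<Sum>j. indicator (U j) x * (1/4)^j)" for x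
  have geo: "summable (\<lambda>j. (1/4::real)^j)" by (simp add: summable_geometric)
  have summ: "summable (\<lambda>j. indicator (U j) x * (1/4::real)^j)" for x
    by (rule summable_comparison_test'[OF geo]) (auto simp: indicator_def)
  show thesis
  proof
    have [measurable]: "U j \<in> sets borel" for j using op by auto
    show "s \<in> borel_measurable borel" unfolding s_def by measurable
  next
    fix x
    have "s x \<le> (\<Sum>j. (1/4::real)^j)" unfolding s_def
      by (intro suminf_le summ geo) (auto simp: indicator_def)
    moreover have "0 \<le> s x" unfolding s_def by (intro suminf_nonneg summ) auto
    ultimately show "s x \<in> {0..2}" by (simp add: suminf_geometric)
  next
    fix e :: real assume "e > 0"
    then obtain N where N: "\<And>x. \<exists>j<N. x \<in> U j \<and> (\<forall>y \<in> U j. dist x y < e)" using fine by metis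
    have "dist x y < e" if d: "\<bar>s x - s y\<bar> < 2/3 * (1/4)^N" for x y
    proof (rule ccontr)
      assume "\<not> dist x y < e"
      then obtain i where i: "i < N" "x \<in> U i" "y \<notin> U i" using N[of x] by blast
      define c :: "nat \<Rightarrow> real" where "c j = indicator (U j) x - indicator (U j) y" for j
      define j where "j = (LEAST j. c j \<noteq> 0)"
      have "c i \<noteq> 0" using i by (simp add: c_def)
      then have j: "c j \<noteq> 0" "j \<le> i" unfolding j_def by (rule LeastI, rule Least_le)
      have lt: "c k = 0" if "k < j" for k using that not_less_Least unfolding j_def by blast
      have "s x - s y = (\<Sum>k. c k * (1/4)^k)"
        unfolding s_def c_def left_diff_distrib by (rule suminf_diff[OF summ summ])
      moreover have "2/3 * (1/4)^j \<le> \<bar>\<Sum>k. c k * (1/4)^k\<bar>"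
        using j lt by (intro quarter_series_lower_bound) (auto simp: c_def indicator_def split: if_splits)
      moreover have "(1/4::real)^N \<le> (1/4)^j" using j i by (intro power_decreasing) auto
      ultimately show False using d by linarith
    qed
    then show "\<exists>d>0. \<forall>x y. \<bar>s x - s y\<bar> < d \<longrightarrow> dist x y < e"
      by (intro exI[of _ "2/3 * (1/4)^N"]) auto
  qed
qed

text \<open>
  Helly's selection theorem only speaks about measures on the line. The code \<open>s\<close> is Borel but in
  general not continuous; its inverse however is uniformly continuous and extends to a
  continuous map \<open>\<pi>\<close> on the closure of the range of \<open>s\<close>, through which the limit is pulled back.
\<close>

theorem borel_probs_seq_compact:
  fixes m :: "nat \<Rightarrow> 'a::metric_space measure"
  assumes cpt: "compact (UNIV :: 'a set)" and m: "\<And>n. m n \<in> borel_probs"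
  obtains r l where "strict_mono r" "l \<in> borel_probs" "weak_lim (m \<circ> r) l"
proof -
  obtain s :: "'a \<Rightarrow> real" where s [measurable]: "s \<in> borel_measurable borel"
    and s_range: "\<And>x. s x \<in> {0..2}"
    and s_inj: "\<And>e. e > 0 \<Longrightarrow> \<exists>d>0. \<forall>x y. \<bar>s x - s y\<bar> < d \<longrightarrow> dist x y < e"
    using compact_UNIV_code[OF cpt] by metis
  define C where "C = closure (range s)"
  have clC: "closed C" by (simp add: C_def)
  have "\<exists>x X. (\<lambda>n. s (X n)) \<longlonglongrightarrow> c \<and> X \<longlonglongrightarrow> x" if "c \<in> C" for c
  proof -
    have "\<exists>Y. (\<forall>n. Y n \<in> range s) \<and> Y \<longlonglongrightarrow> c"
      using that unfolding C_def by (simp only: closure_sequential)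
    then obtain Y where Y: "\<forall>n. Y n \<in> range s" "Y \<longlonglongrightarrow> c" by (elim exE conjE)
    then have "\<forall>n. \<exists>x. Y n = s x" by blast
    then obtain X where X: "\<And>n. Y n = s (X n)" by metis
    obtain x r where r: "strict_mono r" "(X \<circ> r) \<longlonglongrightarrow> x"
      using cpt unfolding compact_eq_seq_compact_metric seq_compact_def by (metis UNIV_I)
    have "(\<lambda>n. s ((X \<circ> r) n)) \<longlonglongrightarrow> c"
      using LIMSEQ_subseq_LIMSEQ[OF Y(2) r(1)] X by (simp add: o_def)
    with r show ?thesis by blast
  qed
  then obtain \<pi> X where X: "\<And>c. c \<in> C \<Longrightarrow> (\<lambda>n. s (X c n)) \<longlonglongrightarrow> c" "\<And>c. c \<in> C \<Longrightarrow> X c \<longlonglongrightarrow> \<pi> c"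
    by metis
  \<comment> \<open>One estimate for both facts about \<open>\<pi>\<close>: a constant second
    sequence yields \<open>\<pi> (s x) = x\<close>, two approximating sequences yield
    continuity.\<close>
  have lim_dist: "dist x y \<le> e"
    if d: "\<And>x y. \<bar>s x - s y\<bar> < d \<Longrightarrow> dist x y < e"
      and lims: "(\<lambda>n. s (Y n)) \<longlonglongrightarrow> b" "Y \<longlonglongrightarrow> x" "(\<lambda>n. s (Z n)) \<longlonglongrightarrow> c" "Z \<longlonglongrightarrow> y"
      and bc: "\<bar>b - c\<bar> < d"
    for x y d e b c Y Z
  proof -
    have "(\<lambda>n. \<bar>s (Y n) - s (Z n)\<bar>) \<longlonglongrightarrow> \<bar>b - c\<bar>" using lims by (intro tendsto_intros)
    then have "\<forall>\<^sub>F n in sequentially. \<bar>s (Y n) - s (Z n)\<bar> < d" using bc by (rule order_tendstoD)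
    then have "\<forall>\<^sub>F n in sequentially. dist (Y n) (Z n) \<le> e"
      by eventually_elim (use d in \<open>auto intro: less_imp_le\<close>)
    moreover have "(\<lambda>n. dist (Y n) (Z n)) \<longlonglongrightarrow> dist x y" using lims by (intro tendsto_intros)
    ultimately show ?thesis by (intro tendsto_upperbound[of _ _ sequentially]) auto
  qed
  have sC: "s x \<in> C" for x unfolding C_def by (meson closure_subset rangeI subsetD)
  have \<pi>_s: "\<pi> (s x) = x" for x
  proof (rule ccontr)
    assume "\<pi> (s x) \<noteq> x"
    then have "0 < dist (\<pi> (s x)) x / 2" by simp
    then obtain d where d: "d > 0" "\<And>u v. \<bar>s u - s v\<bar> < d \<Longrightarrow> dist u v < dist (\<pi> (s x)) x / 2"
      using s_inj by meson
    have "dist (\<pi> (s x)) x \<le> dist (\<pi> (s x)) x / 2"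
      by (rule lim_dist[OF d(2) X(1)[OF sC] X(2)[OF sC], where Z = "\<lambda>_. x" and c = "s x"])
         (use d(1) in auto)
    then show False using \<open>0 < dist (\<pi> (s x)) x / 2\<close> by simp
  qed
  have cont: "continuous_on C \<pi>"
    unfolding continuous_on_iff
  proof (intro ballI allI impI)
    fix c and e :: real assume c: "c \<in> C" "e > 0"
    then obtain d where d: "d > 0" "\<And>u v. \<bar>s u - s v\<bar> < d \<Longrightarrow> dist u v < e / 2"
      using s_inj[of "e/2"] by auto
    have "dist (\<pi> b) (\<pi> c) < e" if "b \<in> C" "dist b c < d" for b
      using lim_dist[OF d(2) X[OF that(1)] X[OF c(1)]] that c(2) by (force simp: dist_real_def)
    then show "\<exists>d>0. \<forall>x'\<in>C. dist x' c < d \<longrightarrow> dist (\<pi> x') (\<pi> c) < e" using d(1) by blast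
  qed
  define M where "M n = distr (m n) borel s" for n
  note [measurable_cong] = borel_probsD(2)[OF m]
  have M: "real_distribution (M n)" for n
    unfolding M_def real_distribution_def real_distribution_axioms_def
    using borel_probsD(1)[OF m] by (auto intro!: prob_space.prob_space_distr)
  have "tight M"
    unfolding tight_def
  proof (intro conjI allI impI)
    fix e :: real assume "e > 0"
    \<comment> \<open>The half-open interval starts at -1 so that the possible value 0 of
      \<open>s\<close> lies inside.\<close>
    have "measure (M n) {-1<..2} = 1" for n
    proof -
      interpret prob_space "m n" using borel_probsD[OF m] by auto
      have "s -` {-1<..2} \<inter> space (m n) = space (m n)" using s_range
        by (auto simp: less_le_trans[of "-1" 0])
      then show ?thesis unfolding M_def by (subst measure_distr) (auto simp: prob_space)
    qed
    then show "\<exists>a b. a < b \<and> (\<forall>n. 1 - e < measure (M n) {a<..b})"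
      using \<open>e > 0\<close> by (intro exI[of _ "-1"] exI[of _ 2]) auto
  qed (use M in auto)
  then obtain r L where r: "strict_mono r" and L: "real_distribution L"
    and conv: "weak_conv_m (M \<circ> id \<circ> r) L"
    using tight_imp_convergent_subsubsequence[of M id] by (auto simp: strict_mono_id)
  interpret L: real_distribution L by fact
  have lim: "(\<lambda>n. \<integral>x. g (s x) \<partial>m (r n)) \<longlonglongrightarrow> (\<integral>c. g c \<partial>L)"
    if "continuous_on UNIV g" "\<And>c. \<bar>g c\<bar> \<le> B" for g :: "real \<Rightarrow> real" and B
  proof -
    have [measurable]: "g \<in> borel_measurable borel" using that by (intro borel_measurable_continuous_onI)
    have "(\<lambda>n. \<integral>c. g c \<partial>(M \<circ> id \<circ> r) n) \<longlonglongrightarrow> (\<integral>c. g c \<partial>L)"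
      by (rule weak_conv_imp_integral_bdd_continuous_conv[OF _ L conv, where B = B])
         (use that M in \<open>auto simp: continuous_on_eq_continuous_at\<close>)
    moreover have "(\<integral>c. g c \<partial>M (r n)) = (\<integral>x. g (s x) \<partial>m (r n))" for n
      unfolding M_def by (subst integral_distr) auto
    ultimately show ?thesis by simp
  qed
  \<comment> \<open>The test function \<open>h\<close> vanishes on the range of \<open>s\<close> and
    is positive off the closed set \<open>C\<close>, so \<open>L\<close> lives on \<open>C\<close>,
    where \<open>\<pi>\<close> is meaningful.\<close>
  have AE_C: "AE c in L. c \<in> C"
  proof -
    define h where "h c = min 1 (infdist c C)" for c :: real
    have ch: "continuous_on UNIV h" unfolding h_def by (intro continuous_intros)
    then have [measurable]: "h \<in> borel_measurable borel" by (rule borel_measurable_continuous_onI)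
    have "(\<lambda>n. \<integral>x. h (s x) \<partial>m (r n)) \<longlonglongrightarrow> (\<integral>c. h c \<partial>L)"
      using ch by (rule lim[of h 1]) (auto simp: h_def infdist_nonneg)
    moreover have "h (s x) = 0" for x using sC by (simp add: h_def)
    ultimately have "(\<integral>c. h c \<partial>L) = 0" by (simp add: LIMSEQ_const_iff)
    moreover have "integrable L h"
      by (rule L.integrable_const_bound[of _ 1]) (auto simp: h_def infdist_nonneg)
    ultimately have "AE c in L. h c = 0"
      by (subst (asm) integral_nonneg_eq_0_iff_AE) (auto simp: h_def infdist_nonneg)
    then show ?thesis
    proof eventually_elim
      fix c assume "h c = 0"
      then have "infdist c C = 0" by (auto simp: h_def min_def split: if_splits)
      moreover have "C \<noteq> {}" using sC by blast
      ultimately show "c \<in> C" using clC by (simp add: in_closed_iff_infdist_zero)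
    qed
  qed
  \<comment> \<open>The default value off \<open>C\<close> makes the map Borel on the whole line;
    \<open>L\<close> does not see it.\<close>
  define \<pi>' where "\<pi>' c = (if c \<in> C then \<pi> c else undefined)" for c
  have [measurable]: "\<pi>' \<in> borel_measurable borel"
    unfolding \<pi>'_def using clC cont by (intro borel_measurable_continuous_on_if) auto
  define l where "l = distr L borel \<pi>'"
  show thesis
  proof
    show "strict_mono r" by fact
    show "l \<in> borel_probs" unfolding l_def borel_probs_def
      by (auto intro!: L.prob_space_distr)
    show "weak_lim (m \<circ> r) l"
      unfolding weak_lim_def
    proof (intro allI impI)
      fix f :: "'a \<Rightarrow> real" assume f: "continuous_on UNIV f" "bounded (range f)"
      then have [measurable]: "f \<in> borel_measurable borel" by (intro borel_measurable_continuous_onI)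
      obtain B where B: "\<And>x. norm (f x) \<le> B" using f(2) by (auto simp: bounded_iff)
      then have "B \<ge> 0" by (meson norm_ge_zero order_trans)
      have "continuous_on C (\<lambda>c. f (\<pi> c))"
        using cont f(1) by (metis continuous_on_compose2 subset_UNIV)
      \<comment> \<open>Convergence on the line is tested with functions on all of it, so
        \<open>f \<circ> \<pi>\<close> is extended from \<open>C\<close> with the same bound.
        Composed with \<open>s\<close>, the extension is \<open>f\<close> again.\<close>
      then obtain g where g: "continuous_on UNIV g" "\<And>c. c \<in> C \<Longrightarrow> g c = f (\<pi> c)" "\<And>c. norm (g c) \<le> B"
        using Tietze[of C "\<lambda>c. f (\<pi> c)" UNIV B] clC B \<open>B \<ge> 0\<close> by auto
      have [measurable]: "g \<in> borel_measurable borel" using g by (intro borel_measurable_continuous_onI)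
      have "(\<lambda>n. \<integral>x. g (s x) \<partial>m (r n)) \<longlonglongrightarrow> (\<integral>c. g c \<partial>L)"
        using g by (intro lim[of g B]) auto
      moreover have "g (s x) = f x" for x using g(2)[OF sC] \<pi>_s by simp
      moreover have "(\<integral>c. g c \<partial>L) = (\<integral>c. f (\<pi>' c) \<partial>L)"
      proof (rule integral_cong_AE)
        show "AE c in L. g c = f (\<pi>' c)"
          using AE_C by eventually_elim (simp add: \<pi>'_def g(2))
      qed measurable
      moreover have "\<dots> = (\<integral>x. f x \<partial>l)" unfolding l_def by (subst integral_distr) auto
      ultimately show "(\<lambda>n. \<integral>x. f x \<partial>(m \<circ> r) n) \<longlonglongrightarrow> (\<integral>x. f x \<partial>l)" by simp
    qed
  qed
qed

text \<open>The closed-set part of the portmanteau theorem: a bump function dominates the indicator,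
  so \<open>a\<close> survives the limit in \<open>n\<close> for each fixed width, and only then
  does the width shrink.\<close>

lemma weak_lim_measure_closed:
  fixes m :: "nat \<Rightarrow> 'a::metric_space measure"
  assumes "weak_lim m l" "closed C" "l \<in> borel_probs" "\<And>n. m n \<in> borel_probs"
    and "\<And>n. a \<le> measure (m n) C"
  shows "a \<le> measure l C"
proof (cases "C = {}")
  case True
  then show ?thesis using assms(5)[of 0] by simp
next
  case False
  have "a \<le> (\<integral>x. bump C k x \<partial>l)" for k
  proof (rule tendsto_lowerbound)
    show "(\<lambda>n. \<integral>x. bump C k x \<partial>m n) \<longlonglongrightarrow> (\<integral>x. bump C k x \<partial>l)"
      by (intro weak_limD[OF assms(1)] continuous_intros bounded_bump)
    show "\<forall>\<^sub>F n in sequentially. a \<le> (\<integral>x. bump C k x \<partial>m n)"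
      using measure_le_integral_bump[OF assms(2,4)] assms(5) order_trans by (intro always_eventually) blast
  qed simp
  then show ?thesis
    using integral_bump_tendsto[OF assms(2) False assms(3)] by (intro LIMSEQ_le_const) auto
qed

text \<open>Invariance amounts to equal integrals of \<open>f\<close> and \<open>f \<circ> T\<close>
  for continuous \<open>f\<close>. As \<open>T\<close> is continuous, both integrals pass to the
  limit.\<close>

lemma invariant_measures_weak_lim:
  fixes T :: "'a::metric_space \<Rightarrow> 'a"
  assumes "continuous_on UNIV T" "weak_lim m l" "l \<in> borel_probs" "\<And>n. m n \<in> invariant_measures T"
  shows "l \<in> invariant_measures T"
proof -
  note l = borel_probsD[OF assms(3)]
  have T [measurable]: "T \<in> borel_measurable borel" using assms(1) by (rule borel_measurable_continuous_onI)
  have "distr l borel T = l"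
  proof (rule borel_probs_eqI_continuous)
    show "distr l borel T \<in> borel_probs"
      using l by (auto simp: borel_probs_def intro!: prob_space.prob_space_distr)
    fix f :: "'a \<Rightarrow> real" assume f: "continuous_on UNIV f" "bounded (range f)"
    then have [measurable]: "f \<in> borel_measurable borel" by (intro borel_measurable_continuous_onI)
    have eq: "(\<integral>x. f (T x) \<partial>m n) = (\<integral>x. f x \<partial>m n)" for n
    proof -
      note mn = borel_probsD[OF invariant_measuresD(1)[OF assms(4)[of n]]]
      have "(\<integral>x. f (T x) \<partial>m n) = (\<integral>x. f x \<partial>distr (m n) borel T)"
        using mn by (subst integral_distr) auto
      then show ?thesis using invariant_measuresD(2)[OF assms(4)[of n]] by simp
    qed
    have "(\<lambda>n. \<integral>x. f (T x) \<partial>m n) \<longlonglongrightarrow> (\<integral>x. f (T x) \<partial>l)"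
      using f by (intro weak_limD[OF assms(2)])
        (auto intro: continuous_on_compose2[OF f(1) assms(1)] bounded_subset)
    moreover have "(\<lambda>n. \<integral>x. f (T x) \<partial>m n) \<longlonglongrightarrow> (\<integral>x. f x \<partial>l)"
      unfolding eq by (rule weak_limD[OF assms(2) f])
    ultimately have "(\<integral>x. f (T x) \<partial>l) = (\<integral>x. f x \<partial>l)" by (rule LIMSEQ_unique)
    then show "(\<integral>x. f x \<partial>distr l borel T) = (\<integral>x. f x \<partial>l)"
      using l by (subst integral_distr) auto
  qed (rule assms(3))
  then show ?thesis using l by (simp add: invariant_measures_def)
qed


section \<open>Ergodic elements of faces\<close>

lemma integral_uniform_measure:
  fixes f :: "'a \<Rightarrow> real"
  assumes "f \<in> borel_measurable M" "A \<in> sets M" "emeasure M A \<noteq> 0" "emeasure M A \<noteq> \<infinity>"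
  shows "(\<integral>x. f x \<partial>uniform_measure M A) = (\<integral>x. indicator A x * f x \<partial>M) / measure M A"
proof -
  have pos: "measure M A > 0" and eq: "emeasure M A = ennreal (measure M A)"
    using assms(3,4) by (auto simp: emeasure_eq_ennreal_measure zero_less_measure_iff)
  have "uniform_measure M A = density M (\<lambda>x. ennreal (indicator A x / measure M A))"
    unfolding uniform_measure_def eq using pos
    by (auto simp: divide_ennreal ennreal_indicator[symmetric] simp del: ennreal_indicator)
  then have "(\<integral>x. f x \<partial>uniform_measure M A) = (\<integral>x. (indicator A x / measure M A) *\<^sub>R f x \<partial>M)"
    using assms pos by (simp add: integral_density)
  also have "\<dots> = (\<integral>x. indicator A x * f x \<partial>M) / measure M A" by simp
  finally show ?thesis .
qed

lemma borel_probs_uniform_measure: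
  assumes "\<mu> \<in> borel_probs" "0 < measure \<mu> A"
  shows "uniform_measure \<mu> A \<in> borel_probs"
proof -
  interpret prob_space \<mu> using borel_probsD[OF assms(1)] by auto
  show ?thesis
    using assms borel_probsD(2)[OF assms(1)]
    by (auto simp: borel_probs_def emeasure_eq_measure intro!: prob_space_uniform_measure)
qed

lemma invariant_measures_uniform_measure:
  assumes T [measurable]: "T \<in> borel_measurable borel"
    and \<mu>: "\<mu> \<in> invariant_measures T" and A [measurable]: "A \<in> sets borel"
    and inv: "T -` A = A" and pos: "0 < measure \<mu> A"
  shows "uniform_measure \<mu> A \<in> invariant_measures T"
proof -
  note b = borel_probsD[OF invariant_measuresD(1)[OF \<mu>]]
  note [measurable_cong] = b(2)
  note u = borel_probsD[OF borel_probs_uniform_measure[OF invariant_measuresD(1)[OF \<mu>] pos]]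
  have "distr (uniform_measure \<mu> A) borel T = uniform_measure \<mu> A"
  proof (rule measure_eqI)
    fix B assume "B \<in> sets (distr (uniform_measure \<mu> A) borel T)"
    then have [measurable]: "B \<in> sets borel" by simp
    have "emeasure (distr (uniform_measure \<mu> A) borel T) B = emeasure \<mu> (A \<inter> T -` B) / emeasure \<mu> A"
    proof -
      have "T -` B \<in> sets borel" using measurable_sets[OF T, of B] by simp
      then show ?thesis using b u(3) u(4)[OF T] by (subst emeasure_distr) auto
    qed
    also have "A \<inter> T -` B = T -` (A \<inter> B) \<inter> space \<mu>" using inv b(3) by auto
    also have "emeasure \<mu> \<dots> = emeasure (distr \<mu> borel T) (A \<inter> B)"
      by (subst emeasure_distr) auto
    also have "\<dots> = emeasure \<mu> (A \<inter> B)" using invariant_measuresD(2)[OF \<mu>] by simp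
    also have "\<dots> / emeasure \<mu> A = emeasure (uniform_measure \<mu> A) B"
      by simp
    finally show "emeasure (distr (uniform_measure \<mu> A) borel T) B = emeasure (uniform_measure \<mu> A) B" .
  qed (use b in auto)
  then show ?thesis using u by (simp add: invariant_measures_def)
qed

text \<open>
  Every weakly closed extremal subset of the invariant measures is closed under conditioning on
  invariant sets; the latter is all that is needed to find an ergodic element.
\<close>

definition invariant_face :: "('a::metric_space \<Rightarrow> 'a) \<Rightarrow> 'a measure set \<Rightarrow> bool" where
  "invariant_face T M \<longleftrightarrow> M \<subseteq> invariant_measures T \<and>
     (\<forall>m l. range m \<subseteq> M \<longrightarrow> l \<in> borel_probs \<longrightarrow> weak_lim m l \<longrightarrow> l \<in> M) \<and>
     (\<forall>\<mu>\<in>M. \<forall>A\<in>sets borel. T -` A = A \<longrightarrow> 0 < measure \<mu> A \<longrightarrow> uniform_measure \<mu> A \<in> M)"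

text \<open>Sequential upper semicontinuity of integration against \<open>v\<close>, with constant
  lower bounds in place of a limsup. It covers both kinds of function maximized below, elements of
  C(X) and indicators of closed sets.\<close>

definition usc_integrand :: "('a::metric_space \<Rightarrow> real) \<Rightarrow> bool" where
  "usc_integrand v \<longleftrightarrow> v \<in> borel_measurable borel \<and> bounded (range v) \<and>
     (\<forall>m l a. range m \<subseteq> borel_probs \<longrightarrow> l \<in> borel_probs \<longrightarrow> weak_lim m l \<longrightarrow>
        (\<forall>n. a \<le> (\<integral>x. v x \<partial>m n)) \<longrightarrow> a \<le> (\<integral>x. v x \<partial>l))"

lemma usc_integrand_bcontfun: "usc_integrand (apply_bcontfun \<phi>)"
  unfolding usc_integrand_def
proof (intro conjI allI impI)
  show "apply_bcontfun \<phi> \<in> borel_measurable borel" by (intro borel_measurable_continuous_onI) simp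
  fix m l and a :: real assume "weak_lim m l" "\<forall>n. a \<le> (\<integral>x. apply_bcontfun \<phi> x \<partial>m n)"
  then show "a \<le> (\<integral>x. apply_bcontfun \<phi> x \<partial>l)"
    using weak_limD[of m l "apply_bcontfun \<phi>"] by (intro LIMSEQ_le_const) auto
qed simp

lemma usc_integrand_indicator:
  assumes "closed C"
  shows "usc_integrand (indicator C)"
  unfolding usc_integrand_def
proof (intro conjI allI impI)
  show "bounded (range (indicator C :: 'a \<Rightarrow> real))" by (rule boundedI[of _ 1]) (auto simp: indicator_def)
  fix m l and a :: real assume m: "range m \<subseteq> borel_probs" and "l \<in> borel_probs" "weak_lim m l"
    "\<forall>n. a \<le> (\<integral>x. indicator C x \<partial>m n)"
  moreover from m have "m n \<in> borel_probs" for n by auto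
  ultimately show "a \<le> (\<integral>x. indicator C x \<partial>l)"
    using assms weak_lim_measure_closed[of m l C a] by (simp add: borel_probsD(3))
qed (use assms in auto)

definition argmax_measures :: "'a measure set \<Rightarrow> ('a \<Rightarrow> real) \<Rightarrow> 'a measure set" where
  "argmax_measures M v = {\<mu>\<in>M. \<forall>\<nu>\<in>M. (\<integral>x. v x \<partial>\<nu>) \<le> (\<integral>x. v x \<partial>\<mu>)}"

lemma argmax_measures_subset: "argmax_measures M v \<subseteq> M"
  by (auto simp: argmax_measures_def)

lemma argmax_measures_nonempty:
  fixes T :: "'a::metric_space \<Rightarrow> 'a"
  assumes cpt: "compact (UNIV :: 'a set)" and face: "invariant_face T M" and ne: "M \<noteq> {}"
    and v: "usc_integrand v"
  shows "argmax_measures M v \<noteq> {}"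
proof -
  have sub: "M \<subseteq> borel_probs" using face invariant_measuresD(1) by (auto simp: invariant_face_def)
  obtain B where B: "\<And>x. norm (v x) \<le> B" using v by (auto simp: usc_integrand_def bounded_iff)
  define I where "I \<mu> = (\<integral>x. v x \<partial>\<mu>)" for \<mu>
  have "I \<mu> \<le> B" if "\<mu> \<in> M" for \<mu>
  proof -
    interpret prob_space \<mu> using sub that borel_probsD(1) by blast
    show ?thesis unfolding I_def
      using v B sub that
      by (intro integral_le_const borel_probs_integrable) (auto simp: usc_integrand_def abs_le_iff)
  qed
  then have bdd: "bdd_above (I ` M)" by (intro bdd_aboveI2) auto
  define S where "S = Sup (I ` M)"
  have "\<exists>\<mu>\<in>M. S - 1 / Suc n < I \<mu>" for n
    using less_cSup_iff[OF _ bdd, of "S - 1 / Suc n"] ne by (auto simp: S_def)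
  then obtain m where m: "\<And>n. m n \<in> M" "\<And>n. S - 1 / Suc n < I (m n)" by metis
  obtain r l where r: "strict_mono r" "l \<in> borel_probs" "weak_lim (m \<circ> r) l"
    using borel_probs_seq_compact[OF cpt, of m] m sub by blast
  have "S - 1 / Suc k \<le> I l" for k
  proof -
    \<comment> \<open>Without its first \<open>k\<close> terms the sequence has the constant lower
      bound \<open>S - 1 / Suc k\<close> that \<open>usc_integrand\<close> asks for; afterwards
      \<open>k\<close> tends to infinity.\<close>
    have "weak_lim ((m \<circ> r) \<circ> (\<lambda>n. n + k)) l"
      by (rule weak_lim_subseq[OF r(3)]) (auto simp: strict_mono_def)
    moreover have "S - 1 / Suc k \<le> I (m (r (n + k)))" for n
    proof -
      have "k \<le> r (n + k)" using seq_suble[OF r(1), of "n + k"] by simp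
      then have "1 / Suc (r (n + k)) \<le> 1 / Suc k" by (intro frac_le) auto
      then show ?thesis using m(2)[of "r (n + k)"] by linarith
    qed
    moreover have "range ((m \<circ> r) \<circ> (\<lambda>n. n + k)) \<subseteq> borel_probs" using m sub by auto
    ultimately show ?thesis
      using v r(2) unfolding usc_integrand_def I_def by (auto simp: o_def)
  qed
  moreover have "(\<lambda>k. S - 1 / Suc k) \<longlonglongrightarrow> S - 0"
    by (intro tendsto_diff tendsto_const LIMSEQ_inverse_real_of_nat[unfolded inverse_eq_divide])
  ultimately have "S \<le> I l" by (intro LIMSEQ_le_const2[of _ S]) auto
  moreover have "range (m \<circ> r) \<subseteq> M" using m by auto
  then have "l \<in> M" using face r unfolding invariant_face_def by blast
  moreover have "I \<nu> \<le> S" if "\<nu> \<in> M" for \<nu> unfolding S_def by (intro cSup_upper bdd) (use that in auto)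
  ultimately have "l \<in> argmax_measures M v"
    unfolding argmax_measures_def I_def by force
  then show ?thesis by auto
qed

text \<open>Closedness is upper semicontinuity. For conditioning, the maximum \<open>u\<close> is
  the average of the integrals over the conditional measures on \<open>A\<close> and
  \<open>- A\<close>, weighted by their masses. Both are at most \<open>u\<close>, so the one on
  \<open>A\<close> attains it.\<close>

lemma invariant_face_argmax:
  fixes T :: "'a::metric_space \<Rightarrow> 'a"
  assumes face: "invariant_face T M" and v: "usc_integrand v"
  shows "invariant_face T (argmax_measures M v)"
  unfolding invariant_face_def
proof (intro conjI allI impI ballI)
  have sub: "M \<subseteq> borel_probs" using face invariant_measuresD(1) by (auto simp: invariant_face_def)
  note argsub = argmax_measures_subset[of M v]
  show "argmax_measures M v \<subseteq> invariant_measures T"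
    using face argsub by (auto simp: invariant_face_def)
  show "l \<in> argmax_measures M v"
    if "range m \<subseteq> argmax_measures M v" "l \<in> borel_probs" "weak_lim m l" for m l
  proof -
    have "l \<in> M" using face that argsub unfolding invariant_face_def by blast
    moreover have "(\<integral>x. v x \<partial>\<nu>) \<le> (\<integral>x. v x \<partial>l)" if "\<nu> \<in> M" for \<nu>
    proof -
      have "\<forall>n. (\<integral>x. v x \<partial>\<nu>) \<le> (\<integral>x. v x \<partial>m n)"
        using \<open>range m \<subseteq> _\<close> that by (auto simp: argmax_measures_def)
      moreover have "range m \<subseteq> borel_probs" using \<open>range m \<subseteq> _\<close> sub argsub by blast
      ultimately show ?thesis using v \<open>l \<in> borel_probs\<close> \<open>weak_lim m l\<close> unfolding usc_integrand_def by blast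
    qed
    ultimately show ?thesis by (auto simp: argmax_measures_def)
  qed
  fix \<mu> A assume \<mu>: "\<mu> \<in> argmax_measures M v" and A [measurable]: "A \<in> sets borel"
    and inv: "T -` A = A" and pos: "0 < measure \<mu> A"
  have \<mu>M: "\<mu> \<in> M" using \<mu> argsub by blast
  then have b: "\<mu> \<in> borel_probs" using sub by blast
  interpret prob_space \<mu> using borel_probsD[OF b] by auto
  note [measurable_cong] = borel_probsD(2)[OF b]
  have vm [measurable]: "v \<in> borel_measurable borel" and vb: "bounded (range v)"
    using v by (auto simp: usc_integrand_def)
  obtain K where K: "\<And>x. norm (v x) \<le> K" using vb by (auto simp: bounded_iff)
  have cond: "uniform_measure \<mu> B \<in> M" "(\<integral>x. indicator B x * v x \<partial>\<mu>) = measure \<mu> B * (\<integral>x. v x \<partial>uniform_measure \<mu> B)"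
    if [measurable]: "B \<in> sets borel" and "T -` B = B" "0 < measure \<mu> B" for B
  proof -
    show "uniform_measure \<mu> B \<in> M" using face that \<mu>M by (auto simp: invariant_face_def)
    show "(\<integral>x. indicator B x * v x \<partial>\<mu>) = measure \<mu> B * (\<integral>x. v x \<partial>uniform_measure \<mu> B)"
      using that by (subst integral_uniform_measure) (auto simp: emeasure_eq_measure)
  qed
  have integ: "integrable \<mu> (\<lambda>x. indicator B x * v x)" if [measurable]: "B \<in> sets borel" for B
    by (rule integrable_const_bound[of _ K])
       (use K in \<open>auto simp: abs_mult indicator_def intro: order_trans[OF abs_ge_zero]\<close>)
  define u where "u = (\<integral>x. v x \<partial>\<mu>)"
  have le: "(\<integral>x. v x \<partial>\<nu>) \<le> u" if "\<nu> \<in> M" for \<nu> using \<mu> that by (auto simp: argmax_measures_def u_def)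
  \<comment> \<open>If \<open>- A\<close> is null it cannot be conditioned on, and both sides
    vanish; otherwise its conditional measure lies in \<open>M\<close> and has integral at most
    \<open>u\<close>.\<close>
  have compl: "(\<integral>x. indicator (- A) x * v x \<partial>\<mu>) \<le> measure \<mu> (- A) * u"
  proof (cases "measure \<mu> (- A) = 0")
    case True
    then have "AE x in \<mu>. x \<notin> - A" by (subst AE_iff_measurable[of "-A"]) (auto simp: emeasure_eq_measure borel_probsD[OF b])
    then have "AE x in \<mu>. indicator (- A) x * v x = 0" by eventually_elim (auto simp: indicator_def)
    then show ?thesis using True by (simp add: integral_eq_zero_AE)
  next
    case False
    then have "0 < measure \<mu> (- A)" by (simp add: zero_less_measure_iff)
    moreover have "T -` (- A) = - A" using inv by auto
    ultimately show ?thesis using cond[of "- A"] le by (auto intro: mult_left_mono)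
  qed
  have "u = (\<integral>x. indicator A x * v x + indicator (- A) x * v x \<partial>\<mu>)"
    unfolding u_def by (intro Bochner_Integration.integral_cong) (auto simp: indicator_def)
  also have "\<dots> = (\<integral>x. indicator A x * v x \<partial>\<mu>) + (\<integral>x. indicator (- A) x * v x \<partial>\<mu>)"
    using integ by (intro Bochner_Integration.integral_add) auto
  also have "\<dots> \<le> measure \<mu> A * (\<integral>x. v x \<partial>uniform_measure \<mu> A) + measure \<mu> (- A) * u"
    using compl cond(2)[OF A inv pos] by simp
  also have "measure \<mu> (- A) = 1 - measure \<mu> A"
    using prob_compl[of A] borel_probsD[OF b] by (simp add: Compl_eq_Diff_UNIV)
  finally have "measure \<mu> A * u \<le> measure \<mu> A * (\<integral>x. v x \<partial>uniform_measure \<mu> A)"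
    by (simp add: algebra_simps)
  then have "u \<le> (\<integral>x. v x \<partial>uniform_measure \<mu> A)" using pos by simp
  then show "uniform_measure \<mu> A \<in> argmax_measures M v"
    using cond(1)[OF A inv pos] le by (force simp: argmax_measures_def)
qed

lemma invariant_face_invariant_measures:
  fixes T :: "'a::metric_space \<Rightarrow> 'a"
  assumes "continuous_on UNIV T"
  shows "invariant_face T (invariant_measures T)"
  unfolding invariant_face_def
  using invariant_measures_weak_lim[OF assms] invariant_measures_uniform_measure
    borel_measurable_continuous_onI[OF assms]
  by (auto simp: range_subsetD)

text \<open>
  Successively maximizing the measures of the sets of a countable closed \<open>\<pi>\<close>-system leaves a single
  measure, which is ergodic because conditioning on an invariant set cannot leave the face.
\<close>

theorem invariant_face_ergodic:
  fixes T :: "'a::metric_space \<Rightarrow> 'a"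
  assumes cpt: "compact (UNIV :: 'a set)" and face: "invariant_face T M" and ne: "M \<noteq> {}"
  shows "M \<inter> ergodic_measures T \<noteq> {}"
proof -
  obtain E :: "nat \<Rightarrow> 'a set" where E: "\<And>j. closed (E j)" "Int_stable (range E)"
    "UNIV \<in> range E" "sigma_sets UNIV (range E) = sets borel"
    using compact_UNIV_countable_closed_generator[OF cpt] by metis
  define N where "N = rec_nat M (\<lambda>j F. argmax_measures F (indicator (E j)))"
  have N: "N 0 = M" "N (Suc j) = argmax_measures (N j) (indicator (E j))" for j
    by (simp_all add: N_def)
  have Nface: "invariant_face T (N j) \<and> N j \<noteq> {}" for j
  proof (induction j)
    case (Suc j)
    then show ?case
      unfolding N using usc_integrand_indicator[OF E(1)]
      by (intro conjI invariant_face_argmax argmax_measures_nonempty[OF cpt, of T]) auto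
  qed (simp add: N face ne)
  have "N (Suc j) \<subseteq> N j" for j unfolding N by (rule argmax_measures_subset)
  then have anti: "j \<le> k \<Longrightarrow> N k \<subseteq> N j" for j k by (rule lift_Suc_antimono_le)
  have sub: "N j \<subseteq> borel_probs" for j
    using Nface[of j] invariant_measuresD(1) by (auto simp: invariant_face_def)
  obtain m where m: "\<And>j. m j \<in> N j" using Nface unfolding ex_in_conv[symmetric] by metis
  obtain r l where r: "strict_mono r" "l \<in> borel_probs" "weak_lim (m \<circ> r) l"
    using borel_probs_seq_compact[OF cpt, of m] m sub by blast
  \<comment> \<open>The sets \<open>N k\<close> decrease and are weakly closed, and \<open>m\<close>
    stays in \<open>N k\<close> from index \<open>k\<close> on; so the limit lies in all of
    them.\<close>
  have l: "l \<in> N k" for k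
  proof -
    have "weak_lim ((m \<circ> r) \<circ> (\<lambda>n. n + k)) l"
      by (rule weak_lim_subseq[OF r(3)]) (auto simp: strict_mono_def)
    moreover have "range ((m \<circ> r) \<circ> (\<lambda>n. n + k)) \<subseteq> N k"
    proof safe
      fix n
      have "k \<le> r (n + k)" using seq_suble[OF r(1), of "n + k"] by simp
      then show "((m \<circ> r) \<circ> (\<lambda>n. n + k)) n \<in> N k" using m[of "r (n + k)"] anti by auto
    qed
    ultimately show ?thesis using Nface[of k] r(2) unfolding invariant_face_def by blast
  qed
  have linv: "l \<in> invariant_measures T" using l[of 0] Nface[of 0] by (auto simp: invariant_face_def)
  interpret prob_space l using borel_probsD[OF r(2)] by auto
  have "measure l A = 0 \<or> measure l A = 1" if A: "A \<in> sets borel" "T -` A = A" for A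
  proof (rule ccontr)
    assume "\<not> ?thesis"
    then have pos: "0 < measure l A" "measure l A < 1"
      using prob_le_1[of A] by (auto simp: zero_less_measure_iff less_le)
    have "measure l (- A) = 1 - measure l A"
      using prob_compl[of A] borel_probsD[OF r(2)] A by (simp add: Compl_eq_Diff_UNIV)
    then have pos': "0 < measure l (- A)" using pos by simp
    have inv': "- A \<in> sets borel" "T -` (- A) = - A" using A by auto
    have u: "uniform_measure l A \<in> N j" "uniform_measure l (- A) \<in> N j" for j
      using Nface[of j] l[of j] A inv' pos pos' by (auto simp: invariant_face_def)
    \<comment> \<open>Both conditional measures lie in \<open>N (Suc j)\<close>, so each gives
      \<open>E j\<close> the largest mass that occurs in \<open>N j\<close>.\<close>
    have "measure (uniform_measure l A) (E j) = measure (uniform_measure l (- A)) (E j)" for j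
    proof -
      have "(\<integral>x. indicator (E j) x \<partial>uniform_measure l A) = (\<integral>x. indicator (E j) x \<partial>uniform_measure l (- A) :: real)"
        using u[of "Suc j"] u[of j] unfolding N argmax_measures_def by (intro order_antisym) blast+
      then show ?thesis
        by (simp add: borel_probsD(3)[OF r(2)])
    qed
    then have "uniform_measure l A = uniform_measure l (- A)"
      using u[of 0] sub by (intro borel_probs_eqI_generator[OF E(2-4)]) auto
    then have "measure (uniform_measure l A) A = measure (uniform_measure l (- A)) A" by simp
    moreover have "measure (uniform_measure l A) A = 1"
      using pos A borel_probsD(2)[OF r(2)] by (subst measure_uniform_measure) (auto simp: emeasure_eq_measure)
    moreover have "measure (uniform_measure l (- A)) A = 0"
      using pos' A borel_probsD(2)[OF r(2)] by (subst measure_uniform_measure) (auto simp: emeasure_eq_measure)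
    ultimately show False by simp
  qed
  then have "l \<in> ergodic_measures T" using linv by (auto simp: ergodic_measures_def)
  then show ?thesis using l[of 0] N by auto
qed


section \<open>Generic sets of ergodic measures\<close>

definition birkhoff_sum :: "('a \<Rightarrow> 'a) \<Rightarrow> ('a \<Rightarrow> real) \<Rightarrow> nat \<Rightarrow> 'a \<Rightarrow> real" where
  "birkhoff_sum T f k x = (\<Sum>i<k. f ((T ^^ i) x))"

lemma birkhoff_sum_Suc: "birkhoff_sum T f (Suc k) x = f x + birkhoff_sum T f k (T x)"
  unfolding birkhoff_sum_def by (simp add: sum.lessThan_Suc_shift funpow_swap1 del: sum.lessThan_Suc)

lemma birkhoff_sum_measurable [measurable]:
  assumes [measurable]: "T \<in> borel_measurable borel" "f \<in> borel_measurable borel"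
  shows "birkhoff_sum T f k \<in> borel_measurable borel"
proof -
  have [measurable]: "T ^^ i \<in> borel_measurable borel" for i
    by (induction i) (auto simp: o_def intro: measurable_compose[of _ borel])
  show ?thesis unfolding birkhoff_sum_def by measurable
qed

text \<open>The integer bound exhibits the set as a countable union of Borel sets. At its points the
  averages have limsup at most 0, which is the information about time averages used below.\<close>

definition bounded_birkhoff_sums :: "('a \<Rightarrow> 'a) \<Rightarrow> ('a \<Rightarrow> real) \<Rightarrow> 'a set" where
  "bounded_birkhoff_sums T f = {x. \<exists>C::nat. \<forall>k. birkhoff_sum T f k x \<le> C}"

lemma bounded_birkhoff_sumsI: "(\<And>k. birkhoff_sum T f k x \<le> C) \<Longrightarrow> x \<in> bounded_birkhoff_sums T f"
  unfolding bounded_birkhoff_sums_def mem_Collect_eq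
  by (rule exI[of _ "nat \<lceil>C\<rceil>"]) (meson of_nat_ceiling order_trans)

lemma bounded_birkhoff_sums_measurable [measurable]:
  assumes [measurable]: "T \<in> borel_measurable borel" "f \<in> borel_measurable borel"
  shows "bounded_birkhoff_sums T f \<in> sets borel"
proof -
  have "{x \<in> space borel. \<exists>C::nat. \<forall>k. birkhoff_sum T f k x \<le> C} \<in> sets borel" by measurable
  then show ?thesis by (simp add: bounded_birkhoff_sums_def)
qed

text \<open>One step along the orbit changes the sums by \<open>f x\<close>, hence the bound but not
  its existence. The invariance is exact and not only up to null sets, as the zero-one law in
  \<open>ergodic_measures\<close> demands.\<close>

lemma vimage_bounded_birkhoff_sums: "T -` bounded_birkhoff_sums T f = bounded_birkhoff_sums T f"
proof (intro set_eqI iffI)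
  fix x assume "x \<in> T -` bounded_birkhoff_sums T f"
  then obtain C :: nat where C: "\<And>k. birkhoff_sum T f k (T x) \<le> C" by (auto simp: bounded_birkhoff_sums_def)
  show "x \<in> bounded_birkhoff_sums T f"
  proof (rule bounded_birkhoff_sumsI)
    show "birkhoff_sum T f k x \<le> \<bar>f x\<bar> + C" for k
    proof (cases k)
      case 0
      then show ?thesis by (simp add: birkhoff_sum_def)
    next
      case (Suc n)
      then show ?thesis using C[of n] by (auto simp: birkhoff_sum_Suc abs_if)
    qed
  qed
next
  fix x assume "x \<in> bounded_birkhoff_sums T f"
  then obtain C :: nat where C: "\<And>k. birkhoff_sum T f k x \<le> C" by (auto simp: bounded_birkhoff_sums_def)
  show "x \<in> T -` bounded_birkhoff_sums T f"
    unfolding vimage_eq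
  proof (rule bounded_birkhoff_sumsI)
    show "birkhoff_sum T f k (T x) \<le> C - f x" for k using C[of "Suc k"] by (simp add: birkhoff_sum_Suc)
  qed
qed

section \<open>The maximal ergodic inequality\<close>

lemma integral_invariant_measure:
  fixes f :: "'a::metric_space \<Rightarrow> real"
  assumes "\<mu> \<in> invariant_measures T" and [measurable]: "T \<in> borel_measurable borel" "f \<in> borel_measurable borel"
  shows "(\<integral>x. f (T x) \<partial>\<mu>) = (\<integral>x. f x \<partial>\<mu>)"
proof -
  note [measurable_cong] = borel_probsD(2)[OF invariant_measuresD(1)[OF assms(1)]]
  have "(\<integral>x. f x \<partial>distr \<mu> borel T) = (\<integral>x. f (T x) \<partial>\<mu>)" by (subst integral_distr) auto
  then show ?thesis using invariant_measuresD(2)[OF assms(1)] by simp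
qed

text \<open>Equals \<open>Max {birkhoff_sum T f k x | k \<le> n}\<close>; the recursion is what Garsia's argument uses.\<close>

primrec max_birkhoff_sum :: "('a \<Rightarrow> 'a) \<Rightarrow> ('a \<Rightarrow> real) \<Rightarrow> nat \<Rightarrow> 'a \<Rightarrow> real" where
  "max_birkhoff_sum T f 0 x = 0"
| "max_birkhoff_sum T f (Suc n) x = max 0 (f x + max_birkhoff_sum T f n (T x))"

lemma max_birkhoff_sum_nonneg: "0 \<le> max_birkhoff_sum T f n x"
  by (cases n) auto

lemma max_birkhoff_sum_mono_Suc: "max_birkhoff_sum T f n x \<le> max_birkhoff_sum T f (Suc n) x"
proof (induction n arbitrary: x)
  case (Suc n)
  show ?case using Suc[of "T x"] by (auto simp: max_def)
qed simp

lemma birkhoff_sum_le_max_birkhoff_sum: "birkhoff_sum T f n x \<le> max_birkhoff_sum T f n x"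
proof (induction n arbitrary: x)
  case (Suc n)
  show ?case using Suc[of "T x"] by (simp add: birkhoff_sum_Suc max_def)
qed (simp add: birkhoff_sum_def)

lemma max_birkhoff_sum_bounded:
  assumes "\<And>x. \<bar>f x\<bar> \<le> B"
  shows "max_birkhoff_sum T f n x \<le> n * B"
proof (induction n arbitrary: x)
  case (Suc n)
  have "0 \<le> B" using assms[of x] by linarith
  then show ?case using Suc[of "T x"] assms[of x] by (auto simp: max_def algebra_simps abs_le_iff)
qed simp

lemma max_birkhoff_sum_measurable [measurable]:
  assumes [measurable]: "T \<in> borel_measurable borel" "f \<in> borel_measurable borel"
  shows "max_birkhoff_sum T f n \<in> borel_measurable borel"
proof (induction n)
  case (Suc n)
  note [measurable] = Suc
  have "(\<lambda>x. max 0 (f x + max_birkhoff_sum T f n (T x))) \<in> borel_measurable borel" by measurable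
  then show ?case by (simp add: max_birkhoff_sum.simps(2)[abs_def])
qed (simp add: max_birkhoff_sum.simps(1)[abs_def])

text \<open>Garsia's argument. Where the maximal sum \<open>?P n\<close> is positive,
  \<open>?P n x \<le> f x + ?P n (T x)\<close>; where it is zero,
  \<open>?P n x - ?P n (T x) \<le> 0\<close>. The difference integrates to 0 by invariance, and the
  positivity sets increase with \<open>n\<close>.\<close>

lemma maximal_ergodic_inequality:
  fixes f :: "'a::metric_space \<Rightarrow> real"
  assumes \<mu>: "\<mu> \<in> invariant_measures T" and [measurable]: "T \<in> borel_measurable borel" "f \<in> borel_measurable borel"
    and bdd: "bounded (range f)"
  shows "0 \<le> (\<integral>x. indicator {x. \<exists>n. 0 < max_birkhoff_sum T f n x} x * f x \<partial>\<mu>)"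
proof -
  note b = invariant_measuresD(1)[OF \<mu>]
  interpret prob_space \<mu> using borel_probsD[OF b] by auto
  note [measurable_cong] = borel_probsD(2)[OF b]
  let ?P = "max_birkhoff_sum T f"
  obtain B where B: "\<And>x. \<bar>f x\<bar> \<le> B" using bdd by (auto simp: bounded_iff)
  define D where "D n = {x. 0 < ?P n x}" for n
  have [measurable]: "D n \<in> sets borel" for n
  proof -
    have "{x \<in> space borel. 0 < ?P n x} \<in> sets borel" by measurable
    then show ?thesis by (simp add: D_def)
  qed
  have boundP: "bounded (range (?P n))" for n
    by (rule boundedI[of _ "n * B"]) (auto simp: max_birkhoff_sum_nonneg max_birkhoff_sum_bounded[OF B])
  have bound1: "\<bar>indicator A x * f x\<bar> \<le> B" for A x
    using B[of x] by (auto simp: indicator_def intro: order_trans[OF abs_ge_zero])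
  have "0 \<le> (\<integral>x. indicator (D n) x * f x \<partial>\<mu>)" for n
  proof -
    have "(\<integral>x. ?P n x - ?P n (T x) \<partial>\<mu>) \<le> (\<integral>x. indicator (D n) x * f x \<partial>\<mu>)"
    proof (rule integral_mono)
      show "integrable \<mu> (\<lambda>x. ?P n x - ?P n (T x))"
        using boundP[of n] by (intro Bochner_Integration.integrable_diff borel_probs_integrable b)
          (auto intro: bounded_subset)
      show "integrable \<mu> (\<lambda>x. indicator (D n) x * f x)"
        using bound1 by (intro borel_probs_integrable b) (auto intro!: boundedI)
      fix x
      show "?P n x - ?P n (T x) \<le> indicator (D n) x * f x"
      proof (cases "x \<in> D n")
        case True
        then obtain k where "n = Suc k" by (cases n) (auto simp: D_def)
        then show ?thesis
          using True max_birkhoff_sum_mono_Suc[of T f k "T x"] by (auto simp: D_def max_def split: if_splits)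
      next
        case False
        then show ?thesis using max_birkhoff_sum_nonneg[of T f n "T x"] by (simp add: D_def)
      qed
    qed
    moreover have "(\<integral>x. ?P n x - ?P n (T x) \<partial>\<mu>) = (\<integral>x. ?P n x \<partial>\<mu>) - (\<integral>x. ?P n (T x) \<partial>\<mu>)"
      using boundP[of n] by (intro Bochner_Integration.integral_diff borel_probs_integrable b)
        (auto intro: bounded_subset)
    moreover have "(\<integral>x. ?P n (T x) \<partial>\<mu>) = (\<integral>x. ?P n x \<partial>\<mu>)"
      by (rule integral_invariant_measure[OF \<mu>]) measurable
    ultimately show ?thesis by simp
  qed
  moreover have "(\<lambda>n. \<integral>x. indicator (D n) x * f x \<partial>\<mu>) \<longlonglongrightarrow> (\<integral>x. indicator (\<Union>n. D n) x * f x \<partial>\<mu>)"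
  proof (rule integral_dominated_convergence[where w = "\<lambda>_. B"])
    have "incseq D"
      unfolding D_def using max_birkhoff_sum_mono_Suc[of T f]
      by (intro incseq_SucI) (auto intro: less_le_trans simp del: max_birkhoff_sum.simps)
    then show "AE x in \<mu>. (\<lambda>n. indicator (D n) x * f x) \<longlonglongrightarrow> indicator (\<Union>n. D n) x * f x"
      by (intro AE_I2 tendsto_mult tendsto_const LIMSEQ_indicator_incseq)
  qed (use bound1 in auto)
  ultimately have "0 \<le> (\<integral>x. indicator (\<Union>n. D n) x * f x \<partial>\<mu>)" by (intro LIMSEQ_le_const) auto
  also have "(\<Union>n. D n) = {x. \<exists>n. 0 < ?P n x}" by (auto simp: D_def)
  finally show ?thesis .
qed

text \<open>A set not of full measure would be null by ergodicity. Almost every point would then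
  have a positive Birkhoff sum, the maximal inequality would concern the whole space, and the
  integral could not be negative. This one-sided bound takes the place of pointwise
  convergence.\<close>

lemma ergodic_birkhoff_upper:
  fixes f :: "'a::metric_space \<Rightarrow> real"
  assumes \<mu>: "\<mu> \<in> ergodic_measures T" and [measurable]: "T \<in> borel_measurable borel" "f \<in> borel_measurable borel"
    and bdd: "bounded (range f)" and neg: "(\<integral>x. f x \<partial>\<mu>) < 0"
  shows "measure \<mu> (bounded_birkhoff_sums T f) = 1"
proof (rule ccontr)
  note inv = ergodic_measuresD[OF \<mu>] and b = invariant_measuresD(1)[OF ergodic_measuresD[OF \<mu>]]
  interpret prob_space \<mu> using borel_probsD[OF b] by auto
  note [measurable_cong] = borel_probsD(2)[OF b]
  assume "\<not> ?thesis"
  then have "measure \<mu> (bounded_birkhoff_sums T f) = 0"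
    using \<mu> vimage_bounded_birkhoff_sums[of T f] bounded_birkhoff_sums_measurable[OF assms(2,3)]
    unfolding ergodic_measures_def by blast
  then have "AE x in \<mu>. x \<notin> bounded_birkhoff_sums T f"
    by (subst AE_iff_measurable[of "bounded_birkhoff_sums T f"]) (auto simp: emeasure_eq_measure borel_probsD[OF b])
  then have "AE x in \<mu>. indicator {x. \<exists>n. 0 < max_birkhoff_sum T f n x} x * f x = f x"
  proof eventually_elim
    case (elim x)
    then obtain n where "0 < birkhoff_sum T f n x"
      using bounded_birkhoff_sumsI[of T f x 0] by (metis not_le)
    then have "0 < max_birkhoff_sum T f n x"
      using birkhoff_sum_le_max_birkhoff_sum[of T f n x] by linarith
    then have "x \<in> {x. \<exists>n. 0 < max_birkhoff_sum T f n x}" by blast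
    then show ?case by (simp only: indicator_simps mult_1)
  qed
  moreover have "{x. \<exists>n. 0 < max_birkhoff_sum T f n x} \<in> sets borel"
  proof -
    have "{x \<in> space borel. \<exists>n. 0 < max_birkhoff_sum T f n x} \<in> sets borel" by measurable
    then show ?thesis by simp
  qed
  ultimately have "(\<integral>x. indicator {x. \<exists>n. 0 < max_birkhoff_sum T f n x} x * f x \<partial>\<mu>) = (\<integral>x. f x \<partial>\<mu>)"
    by (intro integral_cong_AE) auto
  then show False using maximal_ergodic_inequality[OF inv assms(2-3) bdd] neg by simp
qed

text \<open>Points of \<open>G\<close> visit every \<open>E j\<close> with the frequency that
  \<open>\<mu>\<close> prescribes, up to every error \<open>1 / Suc n\<close>. Another ergodic
  \<open>\<nu>\<close> disagrees with \<open>\<mu>\<close> on some \<open>E j\<close>, and its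
  typical points violate one of these bounds.\<close>

lemma ergodic_separating_set:
  fixes T :: "'a::metric_space \<Rightarrow> 'a"
  assumes cpt: "compact (UNIV :: 'a set)" and [measurable]: "T \<in> borel_measurable borel"
    and \<mu>: "\<mu> \<in> ergodic_measures T"
  obtains G where "G \<in> sets borel" "measure \<mu> G = 1"
    "\<And>\<nu>. \<nu> \<in> ergodic_measures T \<Longrightarrow> \<nu> \<noteq> \<mu> \<Longrightarrow> measure \<nu> G = 0"
proof -
  obtain E :: "nat \<Rightarrow> 'a set" where E: "\<And>j. closed (E j)" "Int_stable (range E)"
    "UNIV \<in> range E" "sigma_sets UNIV (range E) = sets borel"
    using compact_UNIV_countable_closed_generator[OF cpt] by metis
  have [measurable]: "E j \<in> sets borel" for j using E(1) by auto
  \<comment> \<open>The two signs turn upper bounds for Birkhoff sums into upper and lower bounds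
    for frequencies. The term \<open>1 / Suc n\<close> in \<open>h\<close> makes its
    \<open>\<mu>\<close>-integral strictly negative, as \<open>ergodic_birkhoff_upper\<close>
    requires.\<close>
  define \<sigma> :: "bool \<Rightarrow> real" where "\<sigma> b = (if b then 1 else - 1)" for b
  define h where "h b j n x = \<sigma> b * (indicator (E j) x - measure \<mu> (E j)) - 1 / Suc n" for b j n x
  have hm [measurable]: "h b j n \<in> borel_measurable borel" for b j n unfolding h_def by measurable
  have hb: "bounded (range (h b j n))" for b j n
  proof (rule boundedI)
    have "measure \<mu> (E j) \<le> 1" "0 \<le> measure \<mu> (E j)"
      using prob_space.prob_le_1[OF borel_probsD(1)[OF invariant_measuresD(1)[OF ergodic_measuresD[OF \<mu>]]]] by auto
    moreover have "1 / Suc n \<le> (1::real)" "0 \<le> 1 / Suc n" by auto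
    moreover have "\<bar>\<sigma> b\<bar> = 1" by (simp add: \<sigma>_def)
    ultimately have *: "\<bar>\<sigma> b * (indicator (E j) x - measure \<mu> (E j))\<bar> \<le> 1" for x
      by (simp add: abs_mult indicator_def)
    have "\<bar>h b j n x\<bar> \<le> 2" for x
      using *[of x] \<open>1 / Suc n \<le> 1\<close> \<open>0 \<le> 1 / Suc n\<close> unfolding h_def by linarith
    then show "norm y \<le> 2" if "y \<in> range (h b j n)" for y using that by auto
  qed
  have int_h: "(\<integral>x. h b j n x \<partial>\<nu>) = \<sigma> b * (measure \<nu> (E j) - measure \<mu> (E j)) - 1 / Suc n"
    if "\<nu> \<in> borel_probs" for \<nu> b j n
  proof -
    interpret prob_space \<nu> using borel_probsD[OF that] by auto
    have [simp]: "integrable \<nu> (indicator (E j) :: 'a \<Rightarrow> real)"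
      using that by (intro borel_probs_integrable) (auto intro!: boundedI[of _ 1])
    show ?thesis unfolding h_def using borel_probsD(3)[OF that] prob_space by simp
  qed
  define G where "G = (\<Inter>b. \<Inter>j. \<Inter>n. bounded_birkhoff_sums T (h b j n))"
  have Gm: "G \<in> sets borel" unfolding G_def by measurable
  moreover have "measure \<mu> G = 1"
  proof -
    note inv = ergodic_measuresD[OF \<mu>] and b = invariant_measuresD(1)[OF ergodic_measuresD[OF \<mu>]]
    interpret prob_space \<mu> using borel_probsD[OF b] by auto
    have "AE x in \<mu>. x \<in> bounded_birkhoff_sums T (h c j n)" for c j n
    proof -
      have "(\<integral>x. h c j n x \<partial>\<mu>) < 0" by (simp add: int_h[OF b])
      then have "measure \<mu> (bounded_birkhoff_sums T (h c j n)) = 1"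
        by (intro ergodic_birkhoff_upper \<mu> hb) auto
      then show ?thesis using borel_probsD(2)[OF b] by (subst (asm) prob_eq_1) auto
    qed
    then have "AE x in \<mu>. x \<in> G" unfolding G_def by (simp add: AE_all_countable)
    then show ?thesis using Gm borel_probsD(2)[OF b] by (subst prob_eq_1) auto
  qed
  moreover have "measure \<nu> G = 0" if \<nu>: "\<nu> \<in> ergodic_measures T" and ne: "\<nu> \<noteq> \<mu>" for \<nu>
  proof -
    note b = invariant_measuresD(1)[OF ergodic_measuresD[OF \<nu>]]
      and b\<mu> = invariant_measuresD(1)[OF ergodic_measuresD[OF \<mu>]]
    interpret prob_space \<nu> using borel_probsD[OF b] by auto
    obtain j where "measure \<nu> (E j) \<noteq> measure \<mu> (E j)"
      using borel_probs_eqI_generator[OF E(2-4) b b\<mu>] ne by blast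
    moreover define c where "c \<longleftrightarrow> measure \<mu> (E j) < measure \<nu> (E j)"
    ultimately have "0 < \<sigma> c * (measure \<nu> (E j) - measure \<mu> (E j))" (is "0 < ?\<Delta>")
      by (auto simp: \<sigma>_def)
    then obtain n where "1 / Suc n < ?\<Delta>" using reals_Archimedean[of ?\<Delta>] by (auto simp: inverse_eq_divide)
    then have pos: "0 < (\<integral>x. h c j n x \<partial>\<nu>)" (is "0 < ?I") by (simp add: int_h[OF b])
    \<comment> \<open>Half of \<open>?I\<close> splits the difference: \<open>f\<close> has negative
      integral, while the sum of \<open>f\<close> and \<open>h c j n\<close> is a positive constant.
      Its Birkhoff sums grow linearly, so those of the two summands cannot both be bounded
      above.\<close>
    define f where "f x = ?I / 2 - h c j n x" for x
    have int_hc: "integrable \<nu> (h c j n)" by (intro borel_probs_integrable b hb) simp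
    have [measurable]: "f \<in> borel_measurable borel" unfolding f_def by measurable
    have "bounded (range f)" unfolding f_def using hb by (intro bounded_minus_comp) auto
    moreover have "(\<integral>x. f x \<partial>\<nu>) < 0" unfolding f_def using pos int_hc borel_probsD(3)[OF b] prob_space by simp
    ultimately have 1: "measure \<nu> (bounded_birkhoff_sums T f) = 1"
      by (intro ergodic_birkhoff_upper \<nu>) auto
    have disj: "G \<inter> bounded_birkhoff_sums T f = {}"
    proof safe
      fix x assume "x \<in> G" "x \<in> bounded_birkhoff_sums T f"
      then have "x \<in> bounded_birkhoff_sums T (h c j n)" by (auto simp: G_def)
      then obtain C :: nat where C: "\<And>k. birkhoff_sum T (h c j n) k x \<le> C" by (auto simp: bounded_birkhoff_sums_def)
      obtain D :: nat where D: "\<And>k. birkhoff_sum T f k x \<le> D"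
        using \<open>x \<in> bounded_birkhoff_sums T f\<close> by (auto simp: bounded_birkhoff_sums_def)
      have eq: "birkhoff_sum T f k x + birkhoff_sum T (h c j n) k x = k * (?I / 2)" for k :: nat
        by (simp add: birkhoff_sum_def f_def sum.distrib[symmetric])
      have le: "k * (?I / 2) \<le> C + D" for k :: nat
        unfolding eq[symmetric] using C[of k] D[of k] by simp
      obtain k :: nat where "(C + D) / (?I / 2) < k" using reals_Archimedean2 by blast
      then have "C + D < k * (?I / 2)" using pos by (simp add: field_simps)
      then show "x \<in> {}" using le[of k] by linarith
    qed
    have "measure \<nu> G + measure \<nu> (bounded_birkhoff_sums T f) = measure \<nu> (G \<union> bounded_birkhoff_sums T f)"
      using Gm disj borel_probsD(2)[OF b] by (intro finite_measure_Union[symmetric]) auto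
    also have "\<dots> \<le> 1" by simp
    finally show ?thesis using 1 by (simp add: measure_le_0_iff)
  qed
  ultimately show thesis by (rule that)
qed


section \<open>Ekeland's variational principle\<close>

text \<open>Membership in the sets \<open>S x\<close> is transitive by the triangle inequality.
  Nearly minimal points, chosen successively in these sets, have convergent values; the term
  \<open>e * dist\<close> makes them a Cauchy sequence, and no point strictly improves on the
  limit.\<close>

lemma ekeland_variational_principle:
  fixes F :: "'b::complete_space \<Rightarrow> real"
  assumes cont: "continuous_on UNIV F" and nonneg: "\<And>x. 0 \<le> F x" and e: "e > 0"
  obtains y where "e * dist y x0 \<le> F x0" "\<And>z. F y \<le> F z + e * dist z y"
proof -
  define S where "S x = {z. F z + e * dist z x \<le> F x}" for x
  have S_refl: "x \<in> S x" for x by (simp add: S_def)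
  have S_trans: "z \<in> S x" if "z \<in> S y" "y \<in> S x" for x y z
  proof -
    have "e * dist z x \<le> e * (dist z y + dist y x)" using e by (simp add: dist_triangle)
    then show ?thesis using that by (simp add: S_def algebra_simps)
  qed
  have "\<exists>z\<in>S x. \<forall>w\<in>S x. F z \<le> F w + (1/2)^n" for x and n :: nat
  proof -
    have bdd: "bdd_below (F ` S x)" using nonneg by (intro bdd_belowI2)
    have "Inf (F ` S x) < Inf (F ` S x) + (1/2)^n" by simp
    then obtain z where "z \<in> S x" "F z < Inf (F ` S x) + (1/2)^n"
      using S_refl bdd by (subst (asm) cInf_less_iff) auto
    moreover have "Inf (F ` S x) \<le> F w" if "w \<in> S x" for w using bdd that by (intro cInf_lower) auto
    ultimately show ?thesis by force
  qed
  then obtain step where step: "\<And>x n. step x n \<in> S x" "\<And>x n w. w \<in> S x \<Longrightarrow> F (step x n) \<le> F w + (1/2)^n"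
    by metis
  define X where "X = rec_nat x0 (\<lambda>n x. step x n)"
  have X: "X 0 = x0" "X (Suc n) = step (X n) n" for n by (simp_all add: X_def)
  have X_S: "X (n + k) \<in> S (X n)" for n k
    by (induction k) (auto simp: X S_refl intro: S_trans step)
  have S_bound: "dist z x \<le> (F x - F z) / e" if "z \<in> S x" for x z
    using that e by (simp add: S_def field_simps)
  have "decseq (\<lambda>n. F (X n))"
  proof (rule decseq_SucI)
    show "F (X (Suc n)) \<le> F (X n)" for n
    proof -
      have "0 \<le> e * dist (X (Suc n)) (X n)" using e by simp
      moreover have "F (X (Suc n)) + e * dist (X (Suc n)) (X n) \<le> F (X n)"
        using X_S[of n 1] by (simp add: S_def)
      ultimately show ?thesis by linarith
    qed
  qed
  then obtain L where "(\<lambda>n. F (X n)) \<longlonglongrightarrow> L" 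
    using decseq_convergent[of "\<lambda>n. F (X n)" 0] nonneg by metis
  then have "Cauchy (\<lambda>n. F (X n))" by (rule LIMSEQ_imp_Cauchy)
  have "Cauchy X"
    unfolding Cauchy_altdef
  proof (intro allI impI)
    fix d :: real assume "d > 0"
    then have "0 < d * e" using e by simp
    then obtain M where M: "\<And>m n. m \<ge> M \<Longrightarrow> n > m \<Longrightarrow> dist (F (X m)) (F (X n)) < d * e"
      using \<open>Cauchy (\<lambda>n. F (X n))\<close> unfolding Cauchy_altdef by blast
    have "dist (X m) (X n) < d" if "m \<ge> M" "n > m" for m n
    proof -
      have "dist (X n) (X m) \<le> (F (X m) - F (X n)) / e"
        using X_S[of m "n - m"] that by (intro S_bound) auto
      also have "\<dots> < d" using M[OF that] e by (simp add: field_simps dist_real_def abs_less_iff)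
      finally show ?thesis by (simp add: dist_commute)
    qed
    then show "\<exists>M. \<forall>m\<ge>M. \<forall>n>m. dist (X m) (X n) < d" by blast
  qed
  then obtain y where y: "X \<longlonglongrightarrow> y" using Cauchy_convergent convergent_def by blast
  have F_lim: "(\<lambda>n. F (X n)) \<longlonglongrightarrow> F y"
    using cont y by (simp add: continuous_on_eq_continuous_at isCont_tendsto_compose)
  have yS: "y \<in> S (X n)" for n
  proof -
    have "(\<lambda>k. F (X (k + n)) + e * dist (X (k + n)) (X n)) \<longlonglongrightarrow> F y + e * dist y (X n)"
      using LIMSEQ_ignore_initial_segment[OF y] LIMSEQ_ignore_initial_segment[OF F_lim] by (intro tendsto_intros)
    moreover have "\<forall>k. F (X (k + n)) + e * dist (X (k + n)) (X n) \<le> F (X n)"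
      using X_S[of n] by (auto simp: S_def add.commute)
    ultimately have "F y + e * dist y (X n) \<le> F (X n)" by (intro LIMSEQ_le_const2) auto
    then show ?thesis by (simp add: S_def)
  qed
  show thesis
  proof
    show "e * dist y x0 \<le> F x0" using yS[of 0] nonneg[of y] by (simp add: S_def X)
    show "F y \<le> F z + e * dist z y" for z
    proof (rule ccontr)
      \<comment> \<open>A strictly better \<open>z\<close> would belong to every
        \<open>S (X n)\<close>. Near-minimality of the chosen points then forces
        \<open>F y \<le> F z\<close> in the limit.\<close>
      assume less: "\<not> F y \<le> F z + e * dist z y"
      then have "z \<in> S y" by (simp add: S_def)
      then have "z \<in> S (X n)" for n using yS S_trans by blast
      then have "F (X (Suc n)) \<le> F z + (1/2)^n" for n unfolding X by (rule step(2))
      moreover have "(\<lambda>n. F z + (1/2)^n) \<longlonglongrightarrow> F z + 0"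
        by (intro tendsto_intros LIMSEQ_realpow_zero) auto
      ultimately have "F y \<le> F z + 0" using F_lim LIMSEQ_Suc by (blast intro: LIMSEQ_le)
      moreover have "0 \<le> e * dist z y" using e by simp
      ultimately show False using less by linarith
    qed
  qed
qed


section \<open>Averages along arcs\<close>

lemma integral_bcontfun_le_dist:
  fixes \<phi> \<psi> :: "'a::metric_space \<Rightarrow>\<^sub>C real"
  assumes "\<mu> \<in> borel_probs"
  shows "(\<integral>x. \<phi> x \<partial>\<mu>) \<le> (\<integral>x. \<psi> x \<partial>\<mu>) + dist \<phi> \<psi>"
proof -
  interpret prob_space \<mu> using borel_probsD[OF assms] by auto
  have int: "integrable \<mu> (apply_bcontfun f)" for f :: "'a \<Rightarrow>\<^sub>C real"
    by (intro borel_probs_integrable[OF assms] borel_measurable_continuous_onI) auto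
  have "(\<integral>x. \<phi> x \<partial>\<mu>) \<le> (\<integral>x. \<psi> x + dist \<phi> \<psi> \<partial>\<mu>)"
  proof (rule integral_mono)
    show "\<phi> x \<le> \<psi> x + dist \<phi> \<psi>" for x
      using dist_bounded[of \<phi> x \<psi>] by (simp add: dist_real_def abs_le_iff)
  qed (auto intro: int)
  also have "\<dots> = (\<integral>x. \<psi> x \<partial>\<mu>) + dist \<phi> \<psi>"
    using int prob_space by simp
  finally show ?thesis .
qed

lemma continuous_map_weak_star_integral:
  "continuous_map (weak_star_topology T) euclideanreal (\<lambda>\<mu>. \<integral>x. apply_bcontfun \<phi> x \<partial>\<mu>)"
  unfolding continuous_map_def
proof (intro conjI allI impI)
  fix U :: "real set" assume "openin euclideanreal U"
  then have "open U" by simp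
  then show "openin (weak_star_topology T)
     {\<mu> \<in> topspace (weak_star_topology T). (\<integral>x. apply_bcontfun \<phi> x \<partial>\<mu>) \<in> U}"
    unfolding topspace_weak_star_topology unfolding weak_star_topology_def
    by (intro topology_generated_by_Basis) auto
qed simp

lemma ergodic_arc:
  fixes T :: "'a::metric_space \<Rightarrow> 'a"
  assumes "embedding_map (top_of_set {0..1}) (subtopology (weak_star_topology T) (ergodic_measures T)) f"
  shows "\<And>t. t \<in> {0..1} \<Longrightarrow> f t \<in> ergodic_measures T" "inj_on f {0..1::real}"
    "\<And>\<phi> :: 'a \<Rightarrow>\<^sub>C real. continuous_on {0..1} (\<lambda>t. \<integral>x. \<phi> x \<partial>f t)"
proof -
  let ?Y = "subtopology (weak_star_topology T) (ergodic_measures T)"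
  have hom: "homeomorphic_map (top_of_set {0..1}) (subtopology ?Y (f ` {0..1})) f"
    using assms by (simp add: embedding_map_def)
  have cont: "continuous_map (top_of_set {0..1}) ?Y f"
    using homeomorphic_imp_continuous_map[OF hom] by (simp add: continuous_map_in_subtopology)
  show "f t \<in> ergodic_measures T" if "t \<in> {0..1}" for t
    using cont that by (auto simp: continuous_map_in_subtopology)
  show "inj_on f {0..1}" using homeomorphic_imp_injective_map[OF hom] by simp
  show "continuous_on {0..1} (\<lambda>t. \<integral>x. \<phi> x \<partial>f t)" for \<phi> :: "'a \<Rightarrow>\<^sub>C real"
  proof -
    have "continuous_map (top_of_set {0..1}) (weak_star_topology T) f"
      using cont by (simp add: continuous_map_in_subtopology)
    from continuous_map_compose[OF this continuous_map_weak_star_integral[of T \<phi>]]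
    show ?thesis by (simp add: o_def)
  qed
qed

text \<open>The mass of a closed set is a pointwise limit of integrals of bump functions, each
  continuous in \<open>t\<close>, and the closed sets are an intersection-stable generator.\<close>

lemma measurable_prob_algebra_weakly_continuous:
  fixes g :: "real \<Rightarrow> 'a::metric_space measure"
  assumes g: "\<And>t. g t \<in> borel_probs"
    and cont: "\<And>\<phi> :: 'a \<Rightarrow>\<^sub>C real. continuous_on UNIV (\<lambda>t. \<integral>x. \<phi> x \<partial>g t)"
  shows "g \<in> borel \<rightarrow>\<^sub>M prob_algebra borel"
proof (rule measurable_prob_algebra_generated[of borel UNIV "{C. closed C}"])
  fix C :: "'a set" assume "C \<in> {C. closed C}"
  then have C: "closed C" by simp
  show "(\<lambda>t. emeasure (g t) C) \<in> borel_measurable borel"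
  proof (cases "C = {}")
    case False
    have "(\<lambda>t. measure (g t) C) \<in> borel_measurable borel"
    proof (rule borel_measurable_LIMSEQ_real)
      show "(\<lambda>m. \<integral>x. bump C m x \<partial>g t) \<longlonglongrightarrow> measure (g t) C" for t
        by (rule integral_bump_tendsto[OF C False g])
      fix m
      have "bump C m \<in> bcontfun" by (simp add: bcontfun_def bounded_bump continuous_intros)
      then have "continuous_on UNIV (\<lambda>t. \<integral>x. bump C m x \<partial>g t)"
        using cont[of "Bcontfun (bump C m)"] by (simp add: Bcontfun_inverse)
      then show "(\<lambda>t. \<integral>x. bump C m x \<partial>g t) \<in> borel_measurable borel"
        by (rule borel_measurable_continuous_onI)
    qed
    moreover have "emeasure (g t) C = ennreal (measure (g t) C)" for t
      using finite_measure.emeasure_eq_measure[OF prob_space.finite_measure[OF borel_probsD(1)[OF g]]] .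
    ultimately show ?thesis by simp
  qed simp
qed (use g borel_probsD Int_stable_closed sets_borel_eq_sigma_closed in auto)

text \<open>\<open>\<nu>\<close> is the mean of \<open>f t\<close> for \<open>t\<close> uniformly
  distributed in \<open>{0..d}\<close>. Injectivity enters in the last conclusion: at most one
  parameter gives \<open>\<mu>\<close>, and a single parameter is Lebesgue null.\<close>

lemma arc_average:
  fixes f :: "real \<Rightarrow> 'a::metric_space measure"
  assumes f: "\<And>t. t \<in> {0..1} \<Longrightarrow> f t \<in> borel_probs" and inj: "inj_on f {0..1}"
    and cont: "\<And>\<phi> :: 'a \<Rightarrow>\<^sub>C real. continuous_on {0..1} (\<lambda>t. \<integral>x. \<phi> x \<partial>f t)"
    and d: "0 < d" "d \<le> 1"
  obtains \<nu> where "\<nu> \<in> borel_probs"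
    "\<And>(\<phi> :: 'a \<Rightarrow>\<^sub>C real) c. (\<And>t. t \<in> {0..d} \<Longrightarrow> (\<integral>x. \<phi> x \<partial>f t) \<le> c) \<Longrightarrow> (\<integral>x. \<phi> x \<partial>\<nu>) \<le> c"
    "\<And>(\<phi> :: 'a \<Rightarrow>\<^sub>C real) c. (\<And>t. t \<in> {0..d} \<Longrightarrow> c \<le> (\<integral>x. \<phi> x \<partial>f t)) \<Longrightarrow> c \<le> (\<integral>x. \<phi> x \<partial>\<nu>)"
    "\<And>G \<mu>. G \<in> sets borel \<Longrightarrow> (\<And>t. t \<in> {0..d} \<Longrightarrow> f t \<noteq> \<mu> \<Longrightarrow> measure (f t) G = 0) \<Longrightarrow> measure \<nu> G = 0"
proof -
  \<comment> \<open>Clamping extends the piece of the arc to a weakly continuous family on the whole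
    line without changing it on \<open>{0..d}\<close>.\<close>
  define clamp where "clamp t = max 0 (min d t)" for t
  have clamp: "clamp t \<in> {0..d}" "clamp t \<in> {0..1}" for t using d by (auto simp: clamp_def)
  have clamp_cont: "continuous_on UNIV clamp" unfolding clamp_def by (intro continuous_intros)
  define g where "g t = f (clamp t)" for t
  have g: "g t \<in> borel_probs" for t unfolding g_def using clamp by (intro f)
  have g_cont: "continuous_on UNIV (\<lambda>t. \<integral>x. \<phi> x \<partial>g t)" for \<phi> :: "'a \<Rightarrow>\<^sub>C real"
    unfolding g_def using clamp by (intro continuous_on_compose2[OF cont clamp_cont]) auto
  have g_meas: "g \<in> borel \<rightarrow>\<^sub>M prob_algebra borel"
    by (rule measurable_prob_algebra_weakly_continuous[OF g g_cont])
  define U where "U = uniform_measure lborel {0..d}"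
  have Usets [measurable_cong]: "sets U = sets borel" by (simp add: U_def)
  interpret U: prob_space U unfolding U_def by (rule prob_space_uniform_measure) (use d in auto)
  have Ualg: "U \<in> space (prob_algebra borel)"
    using Usets U.prob_space_axioms by (simp add: space_prob_algebra)
  have g_meas' [measurable]: "g \<in> U \<rightarrow>\<^sub>M prob_algebra borel" using g_meas by simp
  define \<nu> where "\<nu> = U \<bind> g"
  have \<nu>: "\<nu> \<in> borel_probs"
    unfolding borel_probs_def \<nu>_def using prob_space_bind'[OF Ualg g_meas] sets_bind'[OF Ualg g_meas] by simp
  have int_\<nu>: "(\<integral>x. \<phi> x \<partial>\<nu>) = (\<integral>t. (\<integral>x. \<phi> x \<partial>g t) \<partial>U)" for \<phi> :: "'a \<Rightarrow>\<^sub>C real"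
  proof -
    obtain B where "\<And>x. norm (\<phi> x) \<le> B"
      using bounded_apply_bcontfun[of \<phi>] by (auto simp: bounded_iff)
    then show ?thesis unfolding \<nu>_def
      using borel_probsD[OF g] prob_space.emeasure_space_1[OF borel_probsD(1)[OF g]]
      by (intro integral_bind[where K = borel and B = B and B' = 1])
         (auto intro!: borel_measurable_continuous_onI measurable_prob_algebraD g_meas' U.finite_measure_axioms)
  qed
  have int_le: "(\<integral>x. \<phi> x \<partial>\<nu>) \<le> c" if le: "\<And>t. t \<in> {0..d} \<Longrightarrow> (\<integral>x. \<phi> x \<partial>f t) \<le> c"
    for \<phi> :: "'a \<Rightarrow>\<^sub>C real" and c
  proof -
    have "integrable U (\<lambda>t. \<integral>x. \<phi> x \<partial>g t)"
    proof -
      obtain B where B: "\<And>x. norm (\<phi> x) \<le> B"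
        using bounded_apply_bcontfun[of \<phi>] by (auto simp: bounded_iff)
      have "norm (\<integral>x. \<phi> x \<partial>g t) \<le> B" for t
      proof -
        interpret prob_space "g t" using borel_probsD[OF g] by auto
        have "norm (\<integral>x. \<phi> x \<partial>g t) \<le> (\<integral>x. norm (\<phi> x) \<partial>g t)" by (rule integral_norm_bound)
        also have "\<dots> \<le> B"
          using B by (intro integral_le_const integrable_norm borel_probs_integrable[OF g] borel_measurable_continuous_onI) auto
        finally show ?thesis .
      qed
      then show ?thesis
        using borel_measurable_continuous_onI[OF g_cont] by (intro U.integrable_const_bound[of _ B]) auto
    qed
    then have "(\<integral>t. (\<integral>x. \<phi> x \<partial>g t) \<partial>U) \<le> c"
      using le clamp unfolding g_def by (intro U.integral_le_const) auto
    then show ?thesis by (simp add: int_\<nu>)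
  qed
  show thesis
  proof (rule that[OF \<nu> int_le])
    fix \<phi> :: "'a \<Rightarrow>\<^sub>C real" and c assume "\<And>t. t \<in> {0..d} \<Longrightarrow> c \<le> (\<integral>x. \<phi> x \<partial>f t)"
    then show "c \<le> (\<integral>x. \<phi> x \<partial>\<nu>)" using int_le[of "- \<phi>" "- c"] by simp
  next
    fix G \<mu> assume G [measurable]: "G \<in> sets borel"
      and null: "\<And>t. t \<in> {0..d} \<Longrightarrow> f t \<noteq> \<mu> \<Longrightarrow> measure (f t) G = 0"
    define N where "N = {t \<in> {0..d}. f t = \<mu>}"
    have "N \<subseteq> {t}" if "t \<in> N" for t
      using inj d that by (auto simp: N_def inj_on_def)
    then have "finite N" by (metis finite.emptyI finite_insert finite_subset ex_in_conv)
    then have "N \<in> null_sets lborel" by (intro finite_imp_null_set_lborel)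
    then have "AE t in lborel. t \<notin> N" by (rule AE_not_in)
    then have "AE t in U. t \<in> {0..d} \<and> t \<notin> N"
      unfolding U_def by (intro AE_uniform_measureI) auto
    then have "AE t in U. emeasure (g t) G = 0"
    proof eventually_elim
      case (elim t)
      then have "g t = f t" "f t \<noteq> \<mu>" by (auto simp: g_def clamp_def N_def)
      then show ?case
        using null[of t] elim finite_measure.emeasure_eq_measure[OF prob_space.finite_measure[OF borel_probsD(1)[OF g[of t]]]]
        by simp
    qed
    then have "(\<integral>\<^sup>+t. emeasure (g t) G \<partial>U) = 0"
      by (subst nn_integral_0_iff_AE) (auto intro!: measurable_emeasure_kernel[OF measurable_prob_algebraD[OF g_meas']])
    then have "emeasure \<nu> G = 0"
      unfolding \<nu>_def by (subst emeasure_bind_prob_algebra[OF Ualg g_meas G])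
    then show "measure \<nu> G = 0" by (simp add: measure_def)
  qed
qed


section \<open>Ergodic maximizing measures\<close>

lemma maximizing_measures_eq_argmax:
  "maximizing_measures T \<phi> = argmax_measures (invariant_measures T) (apply_bcontfun \<phi>)"
  by (auto simp: maximizing_measures_def argmax_measures_def)

lemma bump_bcontfun: "apply_bcontfun (Bcontfun (bump C m)) = bump C m"
  by (intro Bcontfun_inverse) (simp add: bcontfun_def bounded_bump continuous_intros)

lemma maximizing_measures_nonempty_face:
  fixes T :: "'a::metric_space \<Rightarrow> 'a"
  assumes "compact (UNIV :: 'a set)" "continuous_on UNIV T" "invariant_measures T \<noteq> {}"
  shows "maximizing_measures T \<phi> \<noteq> {}" "invariant_face T (maximizing_measures T \<phi>)"
  unfolding maximizing_measures_eq_argmax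
  using argmax_measures_nonempty[OF assms(1) invariant_face_invariant_measures[OF assms(2)] assms(3)]
    invariant_face_argmax[OF invariant_face_invariant_measures[OF assms(2)]] usc_integrand_bcontfun
  by auto

text \<open>
  The hypothesis says that \<open>\<nu>\<close> is, up to \<open>e\<close> in norm, tangent to \<open>\<phi> \<mapsto> max {\<integral>\<phi> d\<mu>}\<close> at \<open>\<phi>\<close>; here
  \<open>mx \<psi>\<close> is any \<open>\<psi>\<close>-maximizing measure. Perturbing \<open>\<phi>\<close> by small multiples of bump functions around
  \<open>K\<close> forces some \<open>\<phi>\<close>-maximizing measure to charge \<open>K\<close>.
\<close>

lemma maximizing_ergodic_charges:
  fixes T :: "'a::metric_space \<Rightarrow> 'a" and \<phi> :: "'a \<Rightarrow>\<^sub>C real"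
  assumes cpt: "compact (UNIV :: 'a set)" and T: "continuous_on UNIV T"
    and \<nu>: "\<nu> \<in> borel_probs"
    and mx: "\<And>\<psi>. mx \<psi> \<in> maximizing_measures T \<psi>"
    and tangent: "\<And>\<psi>. (\<integral>x. \<phi> x \<partial>mx \<phi>) - (\<integral>x. \<phi> x \<partial>\<nu>) \<le>
       (\<integral>x. \<psi> x \<partial>mx \<psi>) - (\<integral>x. \<psi> x \<partial>\<nu>) + e * dist \<psi> \<phi>"
    and e: "0 \<le> e" and K: "closed K" "e < measure \<nu> K"
  obtains \<mu> where "\<mu> \<in> maximizing_measures T \<phi>" "\<mu> \<in> ergodic_measures T" "0 < measure \<mu> K"
proof -
  have "K \<noteq> {}" using K e by auto
  have mx_inv: "mx \<psi> \<in> invariant_measures T" for \<psi> using mx by (auto simp: maximizing_measures_def)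
  then have mx_prob: "mx \<psi> \<in> borel_probs" for \<psi> by (rule invariant_measuresD)
  have mx_max: "(\<integral>x. \<psi> x \<partial>\<mu>) \<le> (\<integral>x. \<psi> x \<partial>mx \<psi>)" if "\<mu> \<in> invariant_measures T" for \<psi> :: "'a \<Rightarrow>\<^sub>C real" and \<mu>
    using mx that by (auto simp: maximizing_measures_def)
  have integ: "integrable \<mu> (apply_bcontfun \<psi>)" if "\<mu> \<in> borel_probs" for \<mu> and \<psi> :: "'a \<Rightarrow>\<^sub>C real"
    by (intro borel_probs_integrable[OF that] borel_measurable_continuous_onI) auto
  define t :: "nat \<Rightarrow> real" where "t m = 1 / Suc m" for m
  have t: "0 < t m" for m by (simp add: t_def)
  have t0: "t \<longlonglongrightarrow> 0" unfolding t_def by (rule LIMSEQ_inverse_real_of_nat[unfolded inverse_eq_divide])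
  define h where "h m = Bcontfun (bump K m)" for m
  have h: "apply_bcontfun (h m) = bump K m" for m unfolding h_def by (rule bump_bcontfun)
  \<comment> \<open>Step size and bump width shrink together: the first makes the measures
    maximizing \<open>\<psi> m\<close> nearly maximizing for \<open>\<phi>\<close>, the second makes
    their limit charge \<open>K\<close> itself and not only a neighbourhood.\<close>
  define \<psi> where "\<psi> m = \<phi> + t m *\<^sub>R h m" for m
  have \<psi>_int: "(\<integral>x. \<psi> m x \<partial>\<mu>) = (\<integral>x. \<phi> x \<partial>\<mu>) + t m * (\<integral>x. bump K m x \<partial>\<mu>)" if "\<mu> \<in> borel_probs" for m \<mu>
    unfolding \<psi>_def h[symmetric] using integ[OF that] by (simp add: scaleR_bcontfun.rep_eq)
  have bump_int: "0 \<le> (\<integral>x. bump K m x \<partial>\<mu>)" "(\<integral>x. bump K m x \<partial>\<mu>) \<le> 1" if "\<mu> \<in> borel_probs" for m \<mu>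
  proof -
    interpret prob_space \<mu> using borel_probsD[OF that] by auto
    show "0 \<le> (\<integral>x. bump K m x \<partial>\<mu>)" by (simp add: bump_bounds)
    show "(\<integral>x. bump K m x \<partial>\<mu>) \<le> 1"
      using integ[OF that, of "h m"] unfolding h by (intro integral_le_const) (auto simp: bump_bounds)
  qed
  define m where "m n = mx (\<psi> n)" for n
  define c where "c = measure \<nu> K - e"
  have m_prob: "m n \<in> borel_probs" for n unfolding m_def by (rule mx_prob)
  have m_bump: "c \<le> (\<integral>x. bump K n x \<partial>m n)" for n
  proof -
    have "dist (\<psi> n) \<phi> \<le> t n"
    proof (rule dist_bound)
      show "dist (\<psi> n x) (\<phi> x) \<le> t n" for x
        using t[of n] bump_bounds[of K n x]
        by (simp add: \<psi>_def h scaleR_bcontfun.rep_eq dist_real_def abs_mult mult_left_le)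
    qed
    then have "e * dist (\<psi> n) \<phi> \<le> e * t n" using e by (rule mult_left_mono)
    moreover have "(\<integral>x. \<phi> x \<partial>m n) \<le> (\<integral>x. \<phi> x \<partial>mx \<phi>)"
      unfolding m_def by (rule mx_max[OF mx_inv])
    \<comment> \<open>The \<open>\<phi>\<close>-terms drop out because the invariant measure
      \<open>m n\<close> cannot exceed the maximum at \<open>\<phi>\<close>; every remaining term
      carries the factor \<open>t n\<close>.\<close>
    ultimately have "t n * (\<integral>x. bump K n x \<partial>\<nu>) \<le> t n * (\<integral>x. bump K n x \<partial>m n) + e * t n"
      using tangent[of "\<psi> n"] unfolding m_def[symmetric] \<psi>_int[OF \<nu>] \<psi>_int[OF m_prob] by linarith
    then have "t n * (\<integral>x. bump K n x \<partial>\<nu>) \<le> t n * ((\<integral>x. bump K n x \<partial>m n) + e)" by (simp add: algebra_simps)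
    then have "(\<integral>x. bump K n x \<partial>\<nu>) \<le> (\<integral>x. bump K n x \<partial>m n) + e" using t[of n] by simp
    then show ?thesis using measure_le_integral_bump[OF K(1) \<nu>, of n] by (simp add: c_def)
  qed
  have m_max: "(\<integral>x. \<phi> x \<partial>\<mu>) - t n \<le> (\<integral>x. \<phi> x \<partial>m n)" if \<mu>: "\<mu> \<in> invariant_measures T" for \<mu> n
  proof -
    note b = invariant_measuresD(1)[OF \<mu>]
    have "(\<integral>x. \<phi> x \<partial>\<mu>) + t n * (\<integral>x. bump K n x \<partial>\<mu>) \<le> (\<integral>x. \<phi> x \<partial>m n) + t n * (\<integral>x. bump K n x \<partial>m n)"
      using mx_max[OF \<mu>, of "\<psi> n"] unfolding m_def[symmetric] \<psi>_int[OF b] \<psi>_int[OF m_prob] .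
    moreover have "0 \<le> t n * (\<integral>x. bump K n x \<partial>\<mu>)" "t n * (\<integral>x. bump K n x \<partial>m n) \<le> t n"
      using t[of n] bump_int[OF b, of n] bump_int[OF m_prob, of n n] by (auto simp: mult_left_le)
    ultimately show ?thesis by linarith
  qed
  obtain r l where r: "strict_mono r" and l: "l \<in> borel_probs" and lim: "weak_lim (m \<circ> r) l"
    using borel_probs_seq_compact[OF cpt, of m] m_prob by blast
  have "m n \<in> invariant_measures T" for n unfolding m_def by (rule mx_inv)
  then have l_inv: "l \<in> invariant_measures T"
    by (intro invariant_measures_weak_lim[OF T lim l]) simp
  have "l \<in> maximizing_measures T \<phi>"
    unfolding maximizing_measures_def
  proof (intro CollectI conjI ballI l_inv)
    fix \<mu> assume \<mu>: "\<mu> \<in> invariant_measures T"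
    have "(\<lambda>n. (\<integral>x. \<phi> x \<partial>\<mu>) - t (r n)) \<longlonglongrightarrow> (\<integral>x. \<phi> x \<partial>\<mu>) - 0"
      by (intro tendsto_intros LIMSEQ_subseq_LIMSEQ[OF t0 r, unfolded o_def])
    moreover have "(\<lambda>n. \<integral>x. \<phi> x \<partial>m (r n)) \<longlonglongrightarrow> (\<integral>x. \<phi> x \<partial>l)"
      using weak_limD[OF lim, of "apply_bcontfun \<phi>"] by simp
    ultimately have "(\<integral>x. \<phi> x \<partial>\<mu>) - 0 \<le> (\<integral>x. \<phi> x \<partial>l)"
      by (rule LIMSEQ_le) (use m_max[OF \<mu>] in auto)
    then show "(\<integral>x. \<phi> x \<partial>\<mu>) \<le> (\<integral>x. \<phi> x \<partial>l)" by simp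
  qed
  moreover have "c \<le> measure l K"
  proof -
    \<comment> \<open>The test function has to stay fixed while \<open>n\<close> tends to infinity.
      Wider bumps dominate narrower ones, so index \<open>j\<close> serves for all later
      measures.\<close>
    have "c \<le> (\<integral>x. bump K j x \<partial>l)" for j
    proof (rule LIMSEQ_le_const)
      show "(\<lambda>n. \<integral>x. bump K j x \<partial>(m \<circ> r) n) \<longlonglongrightarrow> (\<integral>x. bump K j x \<partial>l)"
        by (intro weak_limD[OF lim] continuous_intros bounded_bump)
      have "c \<le> (\<integral>x. bump K j x \<partial>m (r n))" if "n \<ge> j" for n
      proof -
        have "j \<le> r n" using seq_suble[OF r, of n] that by simp
        then have "(\<integral>x. bump K (r n) x \<partial>m (r n)) \<le> (\<integral>x. bump K j x \<partial>m (r n))"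
          using integ[OF m_prob, of "r n" "h j"] integ[OF m_prob, of "r n" "h (r n)"]
          unfolding h by (intro integral_mono bump_antimono)
        then show ?thesis using m_bump[of "r n"] by linarith
      qed
      then show "\<exists>N. \<forall>n\<ge>N. c \<le> (\<integral>x. bump K j x \<partial>(m \<circ> r) n)" by auto
    qed
    then show ?thesis
      using integral_bump_tendsto[OF K(1) \<open>K \<noteq> {}\<close> l] by (intro LIMSEQ_le_const) auto
  qed
  ultimately have l_max: "l \<in> maximizing_measures T \<phi>" and l_K: "c \<le> measure l K" by auto
  have inv_ne: "invariant_measures T \<noteq> {}" using l_inv by auto
  note face = maximizing_measures_nonempty_face[OF cpt T inv_ne, of \<phi>]
  \<comment> \<open>Among the maximizing measures, those with the largest mass on \<open>K\<close>
    again form a face; its ergodic elements give \<open>K\<close> at least the mass that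
    \<open>l\<close> does.\<close>
  define N where "N = argmax_measures (maximizing_measures T \<phi>) (indicator K)"
  have "invariant_face T N" "N \<noteq> {}" unfolding N_def
    using invariant_face_argmax[OF face(2)] argmax_measures_nonempty[OF cpt face(2,1)]
      usc_integrand_indicator[OF K(1)] by auto
  then obtain \<mu> where \<mu>: "\<mu> \<in> N" "\<mu> \<in> ergodic_measures T"
    using invariant_face_ergodic[OF cpt] by blast
  have "\<mu> \<in> maximizing_measures T \<phi>" using \<mu> argmax_measures_subset unfolding N_def by blast
  moreover have "(\<integral>x. indicator K x \<partial>l) \<le> (\<integral>x. indicator K x \<partial>\<mu> :: real)"
    using \<mu>(1) l_max by (auto simp: N_def argmax_measures_def)
  then have "0 < measure \<mu> K"
    using l_K K(2) borel_probsD(3)[OF l] borel_probsD(3)[OF invariant_measuresD(1)[OF ergodic_measuresD[OF \<mu>(2)]]]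
    by (simp add: c_def)
  ultimately show thesis using \<mu>(2) that by blast
qed

theorem theoremA:
  fixes T :: "'a::metric_space \<Rightarrow> 'a"
  assumes "compact (UNIV :: 'a set)"
    and "continuous_on UNIV T"
    and "arcwise_connected_ergodic T"
  shows "\<exists>D :: ('a \<Rightarrow>\<^sub>C real) set. closure D = UNIV \<and>
           (\<forall>\<phi> \<in> D. uncountable (maximizing_measures T \<phi> \<inter> ergodic_measures T))"
proof -
  note cpt = assms(1) and T = assms(2) and arc = assms(3)
  have T_meas: "T \<in> borel_measurable borel" using T by (rule borel_measurable_continuous_onI)
  have inv_ne: "invariant_measures T \<noteq> {}"
    using arc unfolding arcwise_connected_ergodic_def by (blast dest: ergodic_measuresD)
  note face = maximizing_measures_nonempty_face[OF cpt T inv_ne]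
  have "\<forall>\<psi>. \<exists>\<mu>. \<mu> \<in> maximizing_measures T \<psi>" using face(1) by blast
  then obtain mx where mx: "\<And>\<psi>. mx \<psi> \<in> maximizing_measures T \<psi>" by metis
  define \<Gamma> where "\<Gamma> \<psi> = (\<integral>x. apply_bcontfun \<psi> x \<partial>mx \<psi>)" for \<psi>
  have \<Gamma>_max: "(\<integral>x. \<psi> x \<partial>\<mu>) \<le> \<Gamma> \<psi>" if "\<mu> \<in> invariant_measures T" for \<psi> :: "'a \<Rightarrow>\<^sub>C real" and \<mu>
    using mx that by (auto simp: maximizing_measures_def \<Gamma>_def)
  have \<Gamma>_lip: "\<Gamma> \<phi> \<le> \<Gamma> \<psi> + dist \<phi> \<psi>" for \<phi> \<psi>
  proof -
    have inv: "mx \<phi> \<in> invariant_measures T" using mx by (auto simp: maximizing_measures_def)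
    show ?thesis
      using integral_bcontfun_le_dist[OF invariant_measuresD(1)[OF inv], of \<phi> \<psi>] \<Gamma>_max[OF inv, of \<psi>]
      unfolding \<Gamma>_def by linarith
  qed
  let ?D = "{\<phi>. uncountable (maximizing_measures T \<phi> \<inter> ergodic_measures T)}"
  have dense: "\<exists>\<phi>\<in>?D. dist \<phi> \<phi>\<^sub>0 < e\<^sub>0" if e\<^sub>0: "e\<^sub>0 > 0" for \<phi>\<^sub>0 and e\<^sub>0 :: real
  proof -
    \<comment> \<open>\<open>e < e\<^sub>0\<close> yields the required distance;
      \<open>1 / 4\<close> keeps the slope below \<open>measure \<nu> K\<close>, which will exceed
      \<open>1 / 2\<close>.\<close>
    define e where "e = min (e\<^sub>0 / 2) (1 / 4)"
    have e: "0 < e" "e < e\<^sub>0" "e \<le> 1 / 4" using e\<^sub>0 by (auto simp: e_def)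
    obtain \<mu>\<^sub>0 where \<mu>\<^sub>0: "\<mu>\<^sub>0 \<in> maximizing_measures T \<phi>\<^sub>0" "\<mu>\<^sub>0 \<in> ergodic_measures T"
      using invariant_face_ergodic[OF cpt face(2,1)] by blast
    \<comment> \<open>Of two distinct ergodic measures at least one differs from
      \<open>\<mu>\<^sub>0\<close>, so an arc starts there.\<close>
    obtain \<mu>\<^sub>1 where "\<mu>\<^sub>1 \<in> ergodic_measures T" "\<mu>\<^sub>0 \<noteq> \<mu>\<^sub>1"
      using conjunct1[OF arc[unfolded arcwise_connected_ergodic_def]] by blast
    then obtain f where emb: "embedding_map (top_of_set {0..1::real})
        (subtopology (weak_star_topology T) (ergodic_measures T)) f" and f0: "f 0 = \<mu>\<^sub>0"
      using conjunct2[OF arc[unfolded arcwise_connected_ergodic_def]] \<mu>\<^sub>0(2) by blast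
    note f_erg = ergodic_arc(1)[OF emb] and f_inj = ergodic_arc(2)[OF emb] and f_cont = ergodic_arc(3)[OF emb]
    have f_prob: "f t \<in> borel_probs" if "t \<in> {0..1}" for t
      using invariant_measuresD(1)[OF ergodic_measuresD[OF f_erg[OF that]]] .
    have \<Gamma>0: "\<Gamma> \<phi>\<^sub>0 = (\<integral>x. \<phi>\<^sub>0 x \<partial>\<mu>\<^sub>0)"
    proof (rule order_antisym)
      show "\<Gamma> \<phi>\<^sub>0 \<le> (\<integral>x. \<phi>\<^sub>0 x \<partial>\<mu>\<^sub>0)"
        using \<mu>\<^sub>0(1) mx[of \<phi>\<^sub>0] by (auto simp: maximizing_measures_def \<Gamma>_def)
    qed (rule \<Gamma>_max[OF ergodic_measuresD[OF \<mu>\<^sub>0(2)]])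
    have "0 < e\<^sup>2" using e by simp
    then obtain d where d: "d > 0"
      "\<And>t. t \<in> {0..1} \<Longrightarrow> dist t 0 < d \<Longrightarrow> dist (\<integral>x. \<phi>\<^sub>0 x \<partial>f t) (\<integral>x. \<phi>\<^sub>0 x \<partial>f 0) < e\<^sup>2"
      using f_cont[of \<phi>\<^sub>0] unfolding continuous_on_iff by (metis atLeastAtMost_iff order_refl zero_le_one)
    define \<delta> where "\<delta> = min 1 (d / 2)"
    have \<delta>: "0 < \<delta>" "\<delta> \<le> 1" "\<delta> < d" using d(1) by (auto simp: \<delta>_def)
    have near: "\<Gamma> \<phi>\<^sub>0 - e\<^sup>2 \<le> (\<integral>x. \<phi>\<^sub>0 x \<partial>f t)" if "t \<in> {0..\<delta>}" for t
      using d(2)[of t] that \<delta> unfolding \<Gamma>0 f0 dist_real_def by auto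
    obtain \<nu> where \<nu>: "\<nu> \<in> borel_probs"
      and \<nu>_le: "\<And>(\<phi> :: 'a \<Rightarrow>\<^sub>C real) c. (\<And>t. t \<in> {0..\<delta>} \<Longrightarrow> (\<integral>x. \<phi> x \<partial>f t) \<le> c) \<Longrightarrow> (\<integral>x. \<phi> x \<partial>\<nu>) \<le> c"
      and \<nu>_ge: "\<And>(\<phi> :: 'a \<Rightarrow>\<^sub>C real) c. (\<And>t. t \<in> {0..\<delta>} \<Longrightarrow> c \<le> (\<integral>x. \<phi> x \<partial>f t)) \<Longrightarrow> c \<le> (\<integral>x. \<phi> x \<partial>\<nu>)"
      and \<nu>_null: "\<And>G \<mu>. G \<in> sets borel \<Longrightarrow> (\<And>t. t \<in> {0..\<delta>} \<Longrightarrow> f t \<noteq> \<mu> \<Longrightarrow> measure (f t) G = 0) \<Longrightarrow> measure \<nu> G = 0"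
      using arc_average[OF f_prob f_inj f_cont \<delta>(1,2)] by metis
    define F where "F \<psi> = \<Gamma> \<psi> - (\<integral>x. apply_bcontfun \<psi> x \<partial>\<nu>)" for \<psi>
    have "0 \<le> F \<psi>" for \<psi>
    proof -
      have "(\<integral>x. \<psi> x \<partial>\<nu>) \<le> \<Gamma> \<psi>"
        using \<delta> by (intro \<nu>_le \<Gamma>_max ergodic_measuresD f_erg) auto
      then show ?thesis by (simp add: F_def)
    qed
    moreover have "continuous_on UNIV F"
    proof -
      \<comment> \<open>Both \<open>\<Gamma>\<close> and integration against \<open>\<nu>\<close>
        are 1-Lipschitz.\<close>
      have "F \<phi> \<le> F \<psi> + 2 * dist \<phi> \<psi>" for \<phi> \<psi>
        using \<Gamma>_lip[of \<phi> \<psi>] integral_bcontfun_le_dist[OF \<nu>, of \<psi> \<phi>]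
        by (simp add: F_def dist_commute)
      then have "dist (F \<phi>) (F \<psi>) \<le> 2 * dist \<phi> \<psi>" for \<phi> \<psi>
        by (simp add: dist_real_def abs_le_iff) (metis add.commute diff_le_eq dist_commute)
      then have "2-lipschitz_on UNIV F" by (intro lipschitz_onI) auto
      then show ?thesis by (rule lipschitz_on_continuous_on)
    qed
    ultimately obtain \<phi> where \<phi>: "e * dist \<phi> \<phi>\<^sub>0 \<le> F \<phi>\<^sub>0" "\<And>\<psi>. F \<phi> \<le> F \<psi> + e * dist \<psi> \<phi>"
      using ekeland_variational_principle[of F e \<phi>\<^sub>0] e(1) by metis
    have "F \<phi>\<^sub>0 \<le> e\<^sup>2" using \<nu>_ge[OF near] by (simp add: F_def)
    then have "e * dist \<phi> \<phi>\<^sub>0 \<le> e * e" using \<phi>(1) by (simp add: power2_eq_square)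
    then have "dist \<phi> \<phi>\<^sub>0 < e\<^sub>0" using e by simp
    moreover have "uncountable (maximizing_measures T \<phi> \<inter> ergodic_measures T)"
    proof
      let ?S = "maximizing_measures T \<phi> \<inter> ergodic_measures T"
      assume count: "countable ?S"
      have "\<forall>\<mu>\<in>?S. \<exists>G. G \<in> sets borel \<and> measure \<mu> G = 1 \<and>
          (\<forall>\<rho>\<in>ergodic_measures T. \<rho> \<noteq> \<mu> \<longrightarrow> measure \<rho> G = 0)"
      proof
        fix \<mu> assume "\<mu> \<in> ?S"
        then have "\<mu> \<in> ergodic_measures T" by simp
        then show "\<exists>G. G \<in> sets borel \<and> measure \<mu> G = 1 \<and>
            (\<forall>\<rho>\<in>ergodic_measures T. \<rho> \<noteq> \<mu> \<longrightarrow> measure \<rho> G = 0)"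
          by (rule ergodic_separating_set[OF cpt T_meas]) blast
      qed
      then obtain G where G: "\<And>\<mu>. \<mu> \<in> ?S \<Longrightarrow> G \<mu> \<in> sets borel" "\<And>\<mu>. \<mu> \<in> ?S \<Longrightarrow> measure \<mu> (G \<mu>) = 1"
        "\<And>\<mu> \<rho>. \<mu> \<in> ?S \<Longrightarrow> \<rho> \<in> ergodic_measures T \<Longrightarrow> \<rho> \<noteq> \<mu> \<Longrightarrow> measure \<rho> (G \<mu>) = 0"
        by metis
      interpret \<nu>: prob_space \<nu> using borel_probsD[OF \<nu>] by auto
      note \<nu>D = borel_probsD(2,3)[OF \<nu>]
      define A where "A = - (\<Union>\<mu>\<in>?S. G \<mu>)"
      have A: "A \<in> sets borel" unfolding A_def
        using count G(1) by (intro borel_comp sets.countable_UN') auto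
      have "G \<mu> \<in> null_sets \<nu>" if "\<mu> \<in> ?S" for \<mu>
      proof -
        \<comment> \<open>Every \<open>f t\<close> on the piece is ergodic, so it gives
          \<open>G \<mu>\<close> mass 0 unless it is \<open>\<mu>\<close> itself.\<close>
        have "measure \<nu> (G \<mu>) = 0"
          using G(1,3)[OF that] \<delta> f_erg by (intro \<nu>_null[of _ \<mu>]) auto
        then show ?thesis using G(1)[OF that] \<nu>D by (simp add: null_sets_def \<nu>.emeasure_eq_measure)
      qed
      then have "(\<Union>\<mu>\<in>?S. G \<mu>) \<in> null_sets \<nu>" using count by (intro null_sets_UN') auto
      then have "measure \<nu> (\<Union>\<mu>\<in>?S. G \<mu>) = 0" by (simp add: measure_def null_setsD1)
      then have \<nu>A: "measure \<nu> A = 1"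
        using \<nu>.prob_compl[of A] A \<nu>D by (simp add: A_def Compl_eq_Diff_UNIV[symmetric])
      obtain K V where K: "closed K" "open V" "K \<subseteq> A" "A \<subseteq> V" "measure \<nu> (V - K) < 1 / 2"
        using borel_probs_regular[OF \<nu> A] by (meson half_gt_zero zero_less_one)
      have "1 \<le> measure \<nu> V" using \<nu>A K(2,4) \<nu>D \<nu>.finite_measure_mono[of A V] by auto
      also have "measure \<nu> V = measure \<nu> (V - K) + measure \<nu> K"
        using K \<nu>D by (subst \<nu>.finite_measure_Diff) auto
      finally have "e < measure \<nu> K" using K(5) e by linarith
      then obtain \<mu> where \<mu>: "\<mu> \<in> maximizing_measures T \<phi>" "\<mu> \<in> ergodic_measures T" "0 < measure \<mu> K"
        using maximizing_ergodic_charges[OF cpt T \<nu> mx \<phi>(2)[unfolded F_def \<Gamma>_def] less_imp_le[OF e(1)] K(1)]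
        by metis
      then have "\<mu> \<in> ?S" by auto
      note bD = borel_probsD[OF invariant_measuresD(1)[OF ergodic_measuresD[OF \<mu>(2)]]]
      interpret prob_space \<mu> using bD by auto
      \<comment> \<open>\<open>K\<close> lies in \<open>A\<close> and so misses
        \<open>G \<mu>\<close>, which already carries all the mass of \<open>\<mu>\<close>.\<close>
      have "measure \<mu> K + measure \<mu> (G \<mu>) = measure \<mu> (K \<union> G \<mu>)"
        using K(1,3) G(1)[OF \<open>\<mu> \<in> ?S\<close>] \<open>\<mu> \<in> ?S\<close> bD
        by (intro finite_measure_Union[symmetric]) (auto simp: A_def)
      also have "\<dots> \<le> 1" by simp
      finally show False using G(2)[OF \<open>\<mu> \<in> ?S\<close>] \<mu>(3) by simp
    qed
    ultimately show ?thesis by auto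
  qed
  have "closure ?D = UNIV"
    using dense by (auto simp: closure_approachable)
  then show ?thesis by (intro exI[of _ ?D]) auto
qed

end
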